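(* Let $A$ be a commutative ring with unity and let $\mathfrak{a}$ be an idempotent ideal of $A$ (i.e. $\mathfrak{a}=\mathfrak{a}^2$). The full subcategory $\mathrm{C}(A)_{\mathfrak{a}\text{-com}}$ of $\mathrm{C}(A)$ is abelian.
   Context: $\mathrm{C}(A)$ is the category of chain complexes of $A$-modules. An $A$-module $M$ is $\mathfrak{a}$-adically complete if $M\cong\Lambda_{\mathfrak{a}}(M)$, where $\Lambda_{\mathfrak{a}}(M)=\varprojlim_k (A/\mathfrak{a}^k\otimes_A M)$. A complex is $\mathfrak{a}$-adically complete if each of its modules is; $\mathrm{C}(A)_{\mathfrak{a}\text{-com}}$ is the full subcategory of $\mathrm{C}(A)$ consisting of the $\mathfrak{a}$-adically complete complexes. *)

theory Defs
  imports "HOL-Algebra.Module" "HOL-Algebra.Ideal_Product"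
begin

section \<open>Abelian categories\<close>

text \<open>
  The arrows \<open>X \<rightarrow> Y\<close> form the set \<open>Hom C X Y\<close>; hom-sets of different pairs of objects need not
  be disjoint, which is why \<open>Cmp C X Y Z g f\<close>, the composite of \<open>f : X \<rightarrow> Y\<close> and \<open>g : Y \<rightarrow> Z\<close>,
  carries its objects along.
\<close>

record ('o, 'a) precat =
  Obj :: "'o set"
  Hom :: "'o \<Rightarrow> 'o \<Rightarrow> 'a set"
  Idn :: "'o \<Rightarrow> 'a"
  Cmp :: "'o \<Rightarrow> 'o \<Rightarrow> 'o \<Rightarrow> 'a \<Rightarrow> 'a \<Rightarrow> 'a"

record ('o, 'a) ab_precat = "('o, 'a) precat" +
  HAdd :: "'o \<Rightarrow> 'o \<Rightarrow> 'a \<Rightarrow> 'a \<Rightarrow> 'a"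
  HZero :: "'o \<Rightarrow> 'o \<Rightarrow> 'a"

locale category =
  fixes C :: "('o, 'a, 'z) precat_scheme"
  assumes Idn_closed: "X \<in> Obj C \<Longrightarrow> Idn C X \<in> Hom C X X"
    and Cmp_closed:
      "\<lbrakk>X \<in> Obj C; Y \<in> Obj C; Z \<in> Obj C; f \<in> Hom C X Y; g \<in> Hom C Y Z\<rbrakk>
        \<Longrightarrow> Cmp C X Y Z g f \<in> Hom C X Z"
    and Cmp_Idn_right:
      "\<lbrakk>X \<in> Obj C; Y \<in> Obj C; f \<in> Hom C X Y\<rbrakk> \<Longrightarrow> Cmp C X X Y f (Idn C X) = f"
    and Cmp_Idn_left:
      "\<lbrakk>X \<in> Obj C; Y \<in> Obj C; f \<in> Hom C X Y\<rbrakk> \<Longrightarrow> Cmp C X Y Y (Idn C Y) f = f"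
    and Cmp_assoc:
      "\<lbrakk>W \<in> Obj C; X \<in> Obj C; Y \<in> Obj C; Z \<in> Obj C;
        f \<in> Hom C W X; g \<in> Hom C X Y; h \<in> Hom C Y Z\<rbrakk>
        \<Longrightarrow> Cmp C W Y Z h (Cmp C W X Y g f) = Cmp C W X Z (Cmp C X Y Z h g) f"

definition full_subcategory ::
  "('o, 'a, 'z) precat_scheme \<Rightarrow> 'o set \<Rightarrow> ('o, 'a, 'z) precat_scheme"
  where "full_subcategory C S = C\<lparr>Obj := Obj C \<inter> S\<rparr>"

definition monic :: "('o, 'a, 'z) precat_scheme \<Rightarrow> 'o \<Rightarrow> 'o \<Rightarrow> 'a \<Rightarrow> bool"
  where "monic C X Y f \<longleftrightarrow> f \<in> Hom C X Y \<and>
    (\<forall>T\<in>Obj C. \<forall>u\<in>Hom C T X. \<forall>v\<in>Hom C T X. Cmp C T X Y f u = Cmp C T X Y f v \<longrightarrow> u = v)"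

definition epic :: "('o, 'a, 'z) precat_scheme \<Rightarrow> 'o \<Rightarrow> 'o \<Rightarrow> 'a \<Rightarrow> bool"
  where "epic C X Y f \<longleftrightarrow> f \<in> Hom C X Y \<and>
    (\<forall>T\<in>Obj C. \<forall>u\<in>Hom C Y T. \<forall>v\<in>Hom C Y T. Cmp C X Y T u f = Cmp C X Y T v f \<longrightarrow> u = v)"

definition zero_object :: "('o, 'a, 'z) precat_scheme \<Rightarrow> 'o \<Rightarrow> bool"
  where "zero_object C Z \<longleftrightarrow> Z \<in> Obj C \<and>
    (\<forall>T\<in>Obj C. (\<exists>!f. f \<in> Hom C Z T) \<and> (\<exists>!f. f \<in> Hom C T Z))"

definition is_biproduct ::
  "('o, 'a, 'z) ab_precat_scheme \<Rightarrow> 'o \<Rightarrow> 'o \<Rightarrow> 'o \<Rightarrow> 'a \<Rightarrow> 'a \<Rightarrow> 'a \<Rightarrow> 'a \<Rightarrow> bool"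
  where "is_biproduct C X Y P i j p q \<longleftrightarrow> P \<in> Obj C \<and>
    i \<in> Hom C X P \<and> j \<in> Hom C Y P \<and> p \<in> Hom C P X \<and> q \<in> Hom C P Y \<and>
    Cmp C X P X p i = Idn C X \<and> Cmp C Y P Y q j = Idn C Y \<and>
    Cmp C X P Y q i = HZero C X Y \<and> Cmp C Y P X p j = HZero C Y X \<and>
    HAdd C P P (Cmp C P X P i p) (Cmp C P Y P j q) = Idn C P"

definition is_kernel ::
  "('o, 'a, 'z) ab_precat_scheme \<Rightarrow> 'o \<Rightarrow> 'o \<Rightarrow> 'a \<Rightarrow> 'o \<Rightarrow> 'a \<Rightarrow> bool"
  where "is_kernel C X Y f K k \<longleftrightarrow> K \<in> Obj C \<and> k \<in> Hom C K X \<and>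
    Cmp C K X Y f k = HZero C K Y \<and>
    (\<forall>T\<in>Obj C. \<forall>t\<in>Hom C T X. Cmp C T X Y f t = HZero C T Y \<longrightarrow>
      (\<exists>!u. u \<in> Hom C T K \<and> Cmp C T K X k u = t))"

definition is_cokernel ::
  "('o, 'a, 'z) ab_precat_scheme \<Rightarrow> 'o \<Rightarrow> 'o \<Rightarrow> 'a \<Rightarrow> 'o \<Rightarrow> 'a \<Rightarrow> bool"
  where "is_cokernel C X Y f Q c \<longleftrightarrow> Q \<in> Obj C \<and> c \<in> Hom C Y Q \<and>
    Cmp C X Y Q c f = HZero C X Q \<and>
    (\<forall>T\<in>Obj C. \<forall>t\<in>Hom C Y T. Cmp C X Y T t f = HZero C X T \<longrightarrow>
      (\<exists>!u. u \<in> Hom C Q T \<and> Cmp C Y Q T u c = t))"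

abbreviation hom_group :: "('o, 'a, 'z) ab_precat_scheme \<Rightarrow> 'o \<Rightarrow> 'o \<Rightarrow> 'a monoid"
  where "hom_group C X Y \<equiv>
    \<lparr>carrier = Hom C X Y, monoid.mult = HAdd C X Y, one = HZero C X Y\<rparr>"

locale preadditive_category = category C
  for C :: "('o, 'a, 'z) ab_precat_scheme" +
  assumes hom_comm_group: "\<lbrakk>X \<in> Obj C; Y \<in> Obj C\<rbrakk> \<Longrightarrow> comm_group (hom_group C X Y)"
    and Cmp_HAdd_right:
      "\<lbrakk>X \<in> Obj C; Y \<in> Obj C; Z \<in> Obj C; f \<in> Hom C X Y; f' \<in> Hom C X Y; g \<in> Hom C Y Z\<rbrakk>
        \<Longrightarrow> Cmp C X Y Z g (HAdd C X Y f f') = HAdd C X Z (Cmp C X Y Z g f) (Cmp C X Y Z g f')"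
    and Cmp_HAdd_left:
      "\<lbrakk>X \<in> Obj C; Y \<in> Obj C; Z \<in> Obj C; f \<in> Hom C X Y; g \<in> Hom C Y Z; g' \<in> Hom C Y Z\<rbrakk>
        \<Longrightarrow> Cmp C X Y Z (HAdd C Y Z g g') f = HAdd C X Z (Cmp C X Y Z g f) (Cmp C X Y Z g' f)"

locale abelian_category = preadditive_category C
  for C :: "('o, 'a, 'z) ab_precat_scheme" +
  assumes has_zero_object: "\<exists>Z. zero_object C Z"
    and has_biproducts:
      "\<lbrakk>X \<in> Obj C; Y \<in> Obj C\<rbrakk> \<Longrightarrow> \<exists>P i j p q. is_biproduct C X Y P i j p q"
    and has_kernels:
      "\<lbrakk>X \<in> Obj C; Y \<in> Obj C; f \<in> Hom C X Y\<rbrakk> \<Longrightarrow> \<exists>K k. is_kernel C X Y f K k"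
    and has_cokernels:
      "\<lbrakk>X \<in> Obj C; Y \<in> Obj C; f \<in> Hom C X Y\<rbrakk> \<Longrightarrow> \<exists>Q c. is_cokernel C X Y f Q c"
    and monic_is_kernel:
      "\<lbrakk>X \<in> Obj C; Y \<in> Obj C; monic C X Y f\<rbrakk>
        \<Longrightarrow> \<exists>Z g. Z \<in> Obj C \<and> g \<in> Hom C Y Z \<and> is_kernel C Y Z g X f"
    and epic_is_cokernel:
      "\<lbrakk>X \<in> Obj C; Y \<in> Obj C; epic C X Y f\<rbrakk>
        \<Longrightarrow> \<exists>W g. W \<in> Obj C \<and> g \<in> Hom C W X \<and> is_cokernel C W X g Y f"


section \<open>Modules\<close>

text \<open>
  Homomorphisms are required to be \<^const>\<open>extensional\<close>, so that two of them are equal as HOL functions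
  iff they agree on the carrier of the source. The ring multiplication and unit contained in the
  library's module record play no role for modules and are left unspecified in the constructions
  below.
\<close>

definition mod_hom ::
  "('r, 'x) ring_scheme \<Rightarrow> ('r, 'm, 'y) module_scheme \<Rightarrow> ('r, 'n, 'z) module_scheme \<Rightarrow> ('m \<Rightarrow> 'n) set"
  where "mod_hom R M N = {f \<in> extensional (carrier M).
    f \<in> hom (add_monoid M) (add_monoid N) \<and>
    (\<forall>r\<in>carrier R. \<forall>x\<in>carrier M. f (r \<odot>\<^bsub>M\<^esub> x) = r \<odot>\<^bsub>N\<^esub> f x)}"

definition mod_isomorphic ::
  "('r, 'x) ring_scheme \<Rightarrow> ('r, 'm, 'y) module_scheme \<Rightarrow> ('r, 'n, 'z) module_scheme \<Rightarrow> bool"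
  where "mod_isomorphic R M N \<longleftrightarrow> (\<exists>f\<in>mod_hom R M N. bij_betw f (carrier M) (carrier N))"

definition ring_as_module :: "('r, 'x) ring_scheme \<Rightarrow> ('r, 'r) module"
  where "ring_as_module R = \<lparr>carrier = carrier R, mult = undefined, one = undefined,
    zero = \<zero>\<^bsub>R\<^esub>, add = add R, smult = mult R\<rparr>"

definition quot_module :: "('r, 'm, 'y) module_scheme \<Rightarrow> 'm set \<Rightarrow> ('r, 'm set) module"
  where "quot_module M H = \<lparr>carrier = a_rcosets\<^bsub>M\<^esub> H, mult = undefined, one = undefined,
    zero = H, add = set_add M, smult = (\<lambda>r X. \<Union>x\<in>X. H +>\<^bsub>M\<^esub> (r \<odot>\<^bsub>M\<^esub> x))\<rparr>"

definition submodule_generated ::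
  "('r, 'x) ring_scheme \<Rightarrow> ('r, 'm, 'y) module_scheme \<Rightarrow> 'm set \<Rightarrow> 'm set"
  where "submodule_generated R M S = \<Inter>{H. submodule H R M \<and> S \<subseteq> H}"

definition free_module :: "('r, 'x) ring_scheme \<Rightarrow> 'i set \<Rightarrow> ('r, 'i \<Rightarrow> 'r) module"
  where "free_module R S =
    \<lparr>carrier = {u. range u \<subseteq> carrier R \<and> finite {p. u p \<noteq> \<zero>\<^bsub>R\<^esub>} \<and> {p. u p \<noteq> \<zero>\<^bsub>R\<^esub>} \<subseteq> S},
     mult = undefined, one = undefined,
     zero = (\<lambda>p. \<zero>\<^bsub>R\<^esub>), add = (\<lambda>u v p. u p \<oplus>\<^bsub>R\<^esub> v p), smult = (\<lambda>r u p. r \<otimes>\<^bsub>R\<^esub> u p)\<rparr>"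

definition free_gen :: "('r, 'x) ring_scheme \<Rightarrow> 'i \<Rightarrow> 'i \<Rightarrow> 'r"
  where "free_gen R p = (\<lambda>q. if q = p then \<one>\<^bsub>R\<^esub> else \<zero>\<^bsub>R\<^esub>)"


subsection \<open>Tensor products\<close>

definition tensor_relations ::
  "('r, 'x) ring_scheme \<Rightarrow> ('r, 'm, 'y) module_scheme \<Rightarrow> ('r, 'n, 'z) module_scheme
    \<Rightarrow> ('m \<times> 'n \<Rightarrow> 'r) set"
  where "tensor_relations R M N =
    (let F = free_module R (carrier M \<times> carrier N); e = (\<lambda>m n. free_gen R (m, n)) in
     submodule_generated R F
      ({e (m \<oplus>\<^bsub>M\<^esub> m') n \<ominus>\<^bsub>F\<^esub> (e m n \<oplus>\<^bsub>F\<^esub> e m' n) | m m' n.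
          m \<in> carrier M \<and> m' \<in> carrier M \<and> n \<in> carrier N} \<union>
       {e m (n \<oplus>\<^bsub>N\<^esub> n') \<ominus>\<^bsub>F\<^esub> (e m n \<oplus>\<^bsub>F\<^esub> e m n') | m n n'.
          m \<in> carrier M \<and> n \<in> carrier N \<and> n' \<in> carrier N} \<union>
       {e (r \<odot>\<^bsub>M\<^esub> m) n \<ominus>\<^bsub>F\<^esub> r \<odot>\<^bsub>F\<^esub> e m n | r m n.
          r \<in> carrier R \<and> m \<in> carrier M \<and> n \<in> carrier N} \<union>
       {e m (r \<odot>\<^bsub>N\<^esub> n) \<ominus>\<^bsub>F\<^esub> r \<odot>\<^bsub>F\<^esub> e m n | r m n.
          r \<in> carrier R \<and> m \<in> carrier M \<and> n \<in> carrier N}))"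

definition tensor_module ::
  "('r, 'x) ring_scheme \<Rightarrow> ('r, 'm, 'y) module_scheme \<Rightarrow> ('r, 'n, 'z) module_scheme
    \<Rightarrow> ('r, ('m \<times> 'n \<Rightarrow> 'r) set) module"
  where "tensor_module R M N =
    quot_module (free_module R (carrier M \<times> carrier N)) (tensor_relations R M N)"

definition pure_tensor ::
  "('r, 'x) ring_scheme \<Rightarrow> ('r, 'm, 'y) module_scheme \<Rightarrow> ('r, 'n, 'z) module_scheme
    \<Rightarrow> 'm \<Rightarrow> 'n \<Rightarrow> ('m \<times> 'n \<Rightarrow> 'r) set"
  where "pure_tensor R M N m n =
    tensor_relations R M N +>\<^bsub>free_module R (carrier M \<times> carrier N)\<^esub> free_gen R (m, n)"

text \<open>
  \<open>f \<otimes> g\<close> is the unique homomorphism with \<open>m \<otimes> n \<mapsto> f m \<otimes> g n\<close>.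
\<close>

definition tensor_map ::
  "('r, 'x) ring_scheme \<Rightarrow> ('r, 'm, 'y) module_scheme \<Rightarrow> ('r, 'n, 'z) module_scheme
    \<Rightarrow> ('r, 'm', 'y') module_scheme \<Rightarrow> ('r, 'n', 'z') module_scheme
    \<Rightarrow> ('m \<Rightarrow> 'm') \<Rightarrow> ('n \<Rightarrow> 'n') \<Rightarrow> ('m \<times> 'n \<Rightarrow> 'r) set \<Rightarrow> ('m' \<times> 'n' \<Rightarrow> 'r) set"
  where "tensor_map R M N M' N' f g =
    (THE h. h \<in> mod_hom R (tensor_module R M N) (tensor_module R M' N') \<and>
      (\<forall>m\<in>carrier M. \<forall>n\<in>carrier N.
        h (pure_tensor R M N m n) = pure_tensor R M' N' (f m) (g n)))"


subsection \<open>Adic completion\<close>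

definition inverse_limit_module ::
  "(nat \<Rightarrow> ('r, 'm, 'y) module_scheme) \<Rightarrow> (nat \<Rightarrow> 'm \<Rightarrow> 'm) \<Rightarrow> ('r, nat \<Rightarrow> 'm) module"
  where "inverse_limit_module M t =
    \<lparr>carrier = {x. (\<forall>k. x k \<in> carrier (M k)) \<and> (\<forall>k. t k (x (Suc k)) = x k)},
     mult = undefined, one = undefined,
     zero = (\<lambda>k. \<zero>\<^bsub>M k\<^esub>), add = (\<lambda>x y k. x k \<oplus>\<^bsub>M k\<^esub> y k), smult = (\<lambda>r x k. r \<odot>\<^bsub>M k\<^esub> x k)\<rparr>"

abbreviation ideal_power :: "('r, 'x) ring_scheme \<Rightarrow> 'r set \<Rightarrow> nat \<Rightarrow> 'r set"
  where "ideal_power R I k \<equiv> I [^]\<^bsub>ideals_set R\<^esub> k"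

definition adic_quot :: "('r, 'x) ring_scheme \<Rightarrow> 'r set \<Rightarrow> nat \<Rightarrow> ('r, 'r set) module"
  where "adic_quot R I k = quot_module (ring_as_module R) (ideal_power R I k)"

text \<open>
  The projection \<open>R/I\<^sup>k\<^sup>+\<^sup>1 \<rightarrow> R/I\<^sup>k\<close>: the coset \<open>X\<close> of \<open>I\<^sup>k\<^sup>+\<^sup>1\<close> is contained in the coset
  \<open>I\<^sup>k + X\<close> of \<open>I\<^sup>k\<close>.
\<close>

definition adic_proj :: "('r, 'x) ring_scheme \<Rightarrow> 'r set \<Rightarrow> nat \<Rightarrow> 'r set \<Rightarrow> 'r set"
  where "adic_proj R I k =
    restrict (\<lambda>X. ideal_power R I k <+>\<^bsub>R\<^esub> X) (carrier (adic_quot R I (Suc k)))"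

definition adic_completion ::
  "('r, 'x) ring_scheme \<Rightarrow> 'r set \<Rightarrow> ('r, 'm, 'y) module_scheme
    \<Rightarrow> ('r, nat \<Rightarrow> ('r set \<times> 'm \<Rightarrow> 'r) set) module"
  where "adic_completion R I M =
    inverse_limit_module
      (\<lambda>k. tensor_module R (adic_quot R I k) M)
      (\<lambda>k. tensor_map R (adic_quot R I (Suc k)) M (adic_quot R I k) M
             (adic_proj R I k) (restrict id (carrier M)))"

text \<open>
  Completeness asks for some isomorphism between \<open>M\<close> and its completion, not necessarily the canonical
  map. For an idempotent ideal \<open>I\<close> the two readings agree: either holds iff \<open>I M = 0\<close>.
\<close>

definition adically_complete ::
  "('r, 'x) ring_scheme \<Rightarrow> 'r set \<Rightarrow> ('r, 'm, 'y) module_scheme \<Rightarrow> bool"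
  where "adically_complete R I M \<longleftrightarrow> mod_isomorphic R M (adic_completion R I M)"


section \<open>Chain complexes\<close>

record ('r, 'm) chain_cplx =
  Mdl :: "int \<Rightarrow> ('r, 'm) module"
  Diff :: "int \<Rightarrow> 'm \<Rightarrow> 'm"

definition chain_complex :: "('r, 'x) ring_scheme \<Rightarrow> ('r, 'm) chain_cplx \<Rightarrow> bool"
  where "chain_complex R X \<longleftrightarrow>
    (\<forall>n. module R (Mdl X n)) \<and>
    (\<forall>n. Diff X n \<in> mod_hom R (Mdl X n) (Mdl X (n - 1))) \<and>
    (\<forall>n. \<forall>x\<in>carrier (Mdl X n). Diff X (n - 1) (Diff X n x) = \<zero>\<^bsub>Mdl X (n - 1 - 1)\<^esub>)"

definition chain_maps ::
  "('r, 'x) ring_scheme \<Rightarrow> ('r, 'm) chain_cplx \<Rightarrow> ('r, 'm) chain_cplx \<Rightarrow> (int \<Rightarrow> 'm \<Rightarrow> 'm) set"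
  where "chain_maps R X Y = {f. (\<forall>n. f n \<in> mod_hom R (Mdl X n) (Mdl Y n)) \<and>
    (\<forall>n. \<forall>x\<in>carrier (Mdl X n). Diff Y n (f n x) = f (n - 1) (Diff X n x))}"

text \<open>
  The category of chain complexes of \<open>R\<close>-modules whose carriers are subsets of the type \<open>'m\<close>. The
  type variable \<open>'m\<close> plays the role of the universe of sets; it should be infinite, as a finite type
  is not closed under direct sums up to bijection.
\<close>

definition complex_category ::
  "('r, 'x) ring_scheme \<Rightarrow> (('r, 'm) chain_cplx, int \<Rightarrow> 'm \<Rightarrow> 'm) ab_precat"
  where "complex_category R =
    \<lparr>Obj = {X. chain_complex R X},
     Hom = chain_maps R,
     Idn = (\<lambda>X n. restrict id (carrier (Mdl X n))),
     Cmp = (\<lambda>X Y Z g f n. compose (carrier (Mdl X n)) (g n) (f n)),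
     HAdd = (\<lambda>X Y f g n. restrict (\<lambda>x. f n x \<oplus>\<^bsub>Mdl Y n\<^esub> g n x) (carrier (Mdl X n))),
     HZero = (\<lambda>X Y n. restrict (\<lambda>x. \<zero>\<^bsub>Mdl Y n\<^esub>) (carrier (Mdl X n)))\<rparr>"

definition complete_complex_category ::
  "('r, 'x) ring_scheme \<Rightarrow> 'r set \<Rightarrow> (('r, 'm) chain_cplx, int \<Rightarrow> 'm \<Rightarrow> 'm) ab_precat"
  where "complete_complex_category R I =
    full_subcategory (complex_category R) {X. \<forall>n. adically_complete R I (Mdl X n)}"

end

theory Submission
  imports Defs
begin

text \<open>
  Write \<open>\<Lambda>(M)\<close> for the \<open>I\<close>-adic completion of an \<open>R\<close>-module \<open>M\<close>. If \<open>I\<close> is idempotent, all positive powers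
  of \<open>I\<close> equal \<open>I\<close>, so the inverse system \<open>R/I\<^sup>k \<otimes> M\<close> is \<open>0\<close> at \<open>k = 0\<close> and constantly \<open>R/I \<otimes> M\<close>, that
  is \<open>M/IM\<close>, from then on; hence \<open>\<Lambda>(M)\<close> is \<open>M/IM\<close>. This module is annihilated by \<open>I\<close>. So any
  isomorphism \<open>M \<cong> \<Lambda>(M)\<close> forces \<open>IM = 0\<close>, and if \<open>IM = 0\<close> then the canonical map \<open>M \<rightarrow> \<Lambda>(M)\<close> is
  bijective. This is \<open>adically_complete_iff_annihilated\<close>: the complete complexes are exactly the complexes
  of modules annihilated by \<open>I\<close>, in other words of \<open>R/I\<close>-modules.

  Being annihilated by \<open>I\<close> passes to submodules, quotients and finite direct sums. For any class of modules
  with these closure properties that contains the zero modules, the complexes over it form an abelian category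
  (\<open>abelian_complexes_category\<close>), because kernels, cokernels and biproducts of complexes are computed degree
  by degree and therefore stay in the class. A monomorphism is then injective, hence a kernel of its
  cokernel, and dually for epimorphisms.

  Carriers of modules must be subsets of one fixed type. A quotient is therefore modelled on a set of
  representatives of the cosets, and a direct sum is transported along an injection of
  \<open>'m \<times> 'm\<close> into \<open>'m\<close>, which exists because \<open>'m\<close> is infinite.
\<close>


section \<open>Module homomorphisms\<close>

lemma mod_homI:
  assumes "f \<in> extensional (carrier M)"
    and "\<And>x. x \<in> carrier M \<Longrightarrow> f x \<in> carrier N"
    and "\<And>x y. \<lbrakk>x \<in> carrier M; y \<in> carrier M\<rbrakk> \<Longrightarrow> f (x \<oplus>\<^bsub>M\<^esub> y) = f x \<oplus>\<^bsub>N\<^esub> f y"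
    and "\<And>r x. \<lbrakk>r \<in> carrier R; x \<in> carrier M\<rbrakk> \<Longrightarrow> f (r \<odot>\<^bsub>M\<^esub> x) = r \<odot>\<^bsub>N\<^esub> f x"
  shows "f \<in> mod_hom R M N"
  using assms by (auto simp: mod_hom_def hom_def)

lemma mod_hom_ext: "f \<in> mod_hom R M N \<Longrightarrow> f \<in> extensional (carrier M)"
  by (simp add: mod_hom_def)

lemma mod_hom_closed: "\<lbrakk>f \<in> mod_hom R M N; x \<in> carrier M\<rbrakk> \<Longrightarrow> f x \<in> carrier N"
  by (auto simp: mod_hom_def hom_def)

lemma mod_hom_add:
  "\<lbrakk>f \<in> mod_hom R M N; x \<in> carrier M; y \<in> carrier M\<rbrakk> \<Longrightarrow> f (x \<oplus>\<^bsub>M\<^esub> y) = f x \<oplus>\<^bsub>N\<^esub> f y"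
  by (auto simp: mod_hom_def hom_def)

lemma mod_hom_smult:
  "\<lbrakk>f \<in> mod_hom R M N; r \<in> carrier R; x \<in> carrier M\<rbrakk> \<Longrightarrow> f (r \<odot>\<^bsub>M\<^esub> x) = r \<odot>\<^bsub>N\<^esub> f x"
  by (auto simp: mod_hom_def)

lemma mod_hom_eqI:
  "\<lbrakk>f \<in> mod_hom R M N; g \<in> mod_hom R M N'; \<And>x. x \<in> carrier M \<Longrightarrow> f x = g x\<rbrakk> \<Longrightarrow> f = g"
  by (rule extensionalityI[OF mod_hom_ext mod_hom_ext])

lemma mod_hom_zero:
  assumes "module R M" "module R N" "f \<in> mod_hom R M N"
  shows "f \<zero>\<^bsub>M\<^esub> = \<zero>\<^bsub>N\<^esub>"
proof -
  interpret M: module R M by fact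
  interpret N: module R N by fact
  have "f (\<zero>\<^bsub>R\<^esub> \<odot>\<^bsub>M\<^esub> \<zero>\<^bsub>M\<^esub>) = \<zero>\<^bsub>R\<^esub> \<odot>\<^bsub>N\<^esub> f \<zero>\<^bsub>M\<^esub>"
    using assms(3) by (intro mod_hom_smult) auto
  then show ?thesis using mod_hom_closed[OF assms(3)] by simp
qed

lemma mod_hom_minus:
  assumes "module R M" "module R N" "f \<in> mod_hom R M N" "x \<in> carrier M"
  shows "f (\<ominus>\<^bsub>M\<^esub> x) = \<ominus>\<^bsub>N\<^esub> f x"
proof -
  interpret M: module R M by fact
  interpret N: module R N by fact
  have "f x \<oplus>\<^bsub>N\<^esub> f (\<ominus>\<^bsub>M\<^esub> x) = \<zero>\<^bsub>N\<^esub>"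
    using mod_hom_add[OF assms(3,4), of "\<ominus>\<^bsub>M\<^esub> x"] mod_hom_zero[OF assms(1-3)] assms(4)
    by (simp add: M.M.r_neg)
  then show ?thesis using assms(4) mod_hom_closed[OF assms(3)]
    by (metis M.M.a_inv_closed N.M.add.inv_equality N.M.add.m_comm)
qed

lemma mod_hom_diff:
  assumes "module R M" "module R N" "f \<in> mod_hom R M N" "x \<in> carrier M" "y \<in> carrier M"
  shows "f (x \<ominus>\<^bsub>M\<^esub> y) = f x \<ominus>\<^bsub>N\<^esub> f y"
proof -
  interpret M: module R M by fact
  show ?thesis using assms mod_hom_add[OF assms(3,4), of "\<ominus>\<^bsub>M\<^esub> y"] mod_hom_minus[OF assms(1-3,5)]
    by (simp add: a_minus_def)
qed

lemma module_diff_eq_zero_iff: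
  assumes "module R M" "x \<in> carrier M" "y \<in> carrier M"
  shows "x \<ominus>\<^bsub>M\<^esub> y = \<zero>\<^bsub>M\<^esub> \<longleftrightarrow> x = y"
proof -
  interpret M: module R M by fact
  show ?thesis
    using assms(2,3) by (metis M.M.a_inv_closed M.M.minus_equality M.M.minus_minus M.M.r_neg a_minus_def)
qed

lemma mod_hom_eq_iff:
  assumes "module R M" "module R N" "f \<in> mod_hom R M N" "x \<in> carrier M" "y \<in> carrier M"
  shows "f x = f y \<longleftrightarrow> f (x \<ominus>\<^bsub>M\<^esub> y) = \<zero>\<^bsub>N\<^esub>"
  using mod_hom_diff[OF assms] module_diff_eq_zero_iff[OF assms(2)] mod_hom_closed[OF assms(3)] assms
  by simp

lemma mod_hom_compose:
  assumes "module R M" "f \<in> mod_hom R M N" "g \<in> mod_hom R N P"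
  shows "compose (carrier M) g f \<in> mod_hom R M P"
proof -
  interpret M: module R M by fact
  show ?thesis
    by (rule mod_homI)
      (simp_all add: compose_eq mod_hom_closed[OF assms(2)] mod_hom_closed[OF assms(3)]
        mod_hom_add[OF assms(2)] mod_hom_add[OF assms(3)]
        mod_hom_smult[OF assms(2)] mod_hom_smult[OF assms(3)])
qed

lemma mod_hom_id: "module R M \<Longrightarrow> restrict id (carrier M) \<in> mod_hom R M M"
  by (rule mod_homI)
    (simp_all add: module.axioms abelian_group.axioms abelian_monoid.a_closed module.smult_closed)

text \<open>
  The module axioms are equations, so they pass to any surjective image on which the operations are the
  induced ones. This avoids checking the axioms again for each kind of quotient.
\<close>

lemma module_surj_image:
  assumes "module R M" and carr: "carrier N = p ` carrier M"
    and add: "\<And>x y. \<lbrakk>x \<in> carrier M; y \<in> carrier M\<rbrakk> \<Longrightarrow> p x \<oplus>\<^bsub>N\<^esub> p y = p (x \<oplus>\<^bsub>M\<^esub> y)"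
    and smult: "\<And>r x. \<lbrakk>r \<in> carrier R; x \<in> carrier M\<rbrakk> \<Longrightarrow> r \<odot>\<^bsub>N\<^esub> p x = p (r \<odot>\<^bsub>M\<^esub> x)"
    and zero: "\<zero>\<^bsub>N\<^esub> = p \<zero>\<^bsub>M\<^esub>"
  shows "module R N"
proof -
  interpret M: module R M by fact
  show ?thesis
  proof (rule moduleI)
    show "cring R" by (rule M.R.is_cring)
    show "abelian_group N"
    proof (rule abelian_groupI)
      fix x assume "x \<in> carrier N"
      then obtain a where a: "a \<in> carrier M" "x = p a" by (auto simp: carr)
      have "p (\<ominus>\<^bsub>M\<^esub> a) \<oplus>\<^bsub>N\<^esub> x = \<zero>\<^bsub>N\<^esub>" using a by (simp add: add zero M.M.l_neg)
      then show "\<exists>y\<in>carrier N. y \<oplus>\<^bsub>N\<^esub> x = \<zero>\<^bsub>N\<^esub>" using a by (auto simp: carr)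
    qed (auto simp: carr add zero M.M.a_ac)
  qed (auto simp: carr add smult M.smult_l_distr M.smult_r_distr M.smult_assoc1)
qed

text \<open>
  The next two lemmas are the module-level source of all universal properties below: a map into \<open>X\<close>
  factors through an injection if its image does, and a map out of \<open>Y\<close> factors through a surjection if it
  vanishes on the kernel.
\<close>

lemma mod_hom_factor_inj:
  assumes "module R K" "module R X" "module R T"
    and k: "k \<in> mod_hom R K X" and inj: "inj_on k (carrier K)"
    and t: "t \<in> mod_hom R T X" and sub: "t ` carrier T \<subseteq> k ` carrier K"
  obtains u where "u \<in> mod_hom R T K" "\<And>x. x \<in> carrier T \<Longrightarrow> k (u x) = t x"
proof
  interpret K: module R K by fact
  interpret T: module R T by fact
  let ?u = "restrict (\<lambda>x. inv_into (carrier K) k (t x)) (carrier T)"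
  have ku: "k (?u x) = t x" and uK: "?u x \<in> carrier K" if "x \<in> carrier T" for x
    using that sub by (auto simp: f_inv_into_f inv_into_into image_subset_iff)
  show "k (?u x) = t x" if "x \<in> carrier T" for x using ku that .
  show "?u \<in> mod_hom R T K"
  proof (rule mod_homI)
    fix x y assume xy: "x \<in> carrier T" "y \<in> carrier T"
    have "k (?u (x \<oplus>\<^bsub>T\<^esub> y)) = k (?u x \<oplus>\<^bsub>K\<^esub> ?u y)"
      using xy uK[OF xy(1)] uK[OF xy(2)]
      by (simp only: ku mod_hom_add[OF k] mod_hom_add[OF t] T.M.a_closed)
    then show "?u (x \<oplus>\<^bsub>T\<^esub> y) = ?u x \<oplus>\<^bsub>K\<^esub> ?u y"
      using uK[OF xy(1)] uK[OF xy(2)] uK[OF T.M.a_closed[OF xy]] inj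
      by (meson K.M.a_closed inj_onD)
  next
    fix r x assume rx: "r \<in> carrier R" "x \<in> carrier T"
    have "k (?u (r \<odot>\<^bsub>T\<^esub> x)) = k (r \<odot>\<^bsub>K\<^esub> ?u x)"
      using rx uK[OF rx(2)] by (simp only: ku mod_hom_smult[OF k] mod_hom_smult[OF t] T.smult_closed)
    then show "?u (r \<odot>\<^bsub>T\<^esub> x) = r \<odot>\<^bsub>K\<^esub> ?u x"
      using rx uK[OF rx(2)] uK[OF T.smult_closed[OF rx]] inj
      by (meson K.smult_closed inj_onD)
  qed (auto intro: uK simp del: restrict_apply)
qed

lemma mod_hom_factor_surj:
  assumes "module R Y" "module R Q" "module R T"
    and c: "c \<in> mod_hom R Y Q" and surj: "c ` carrier Y = carrier Q"
    and t: "t \<in> mod_hom R Y T"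
    and ker: "\<And>y. \<lbrakk>y \<in> carrier Y; c y = \<zero>\<^bsub>Q\<^esub>\<rbrakk> \<Longrightarrow> t y = \<zero>\<^bsub>T\<^esub>"
  obtains u where "u \<in> mod_hom R Q T" "\<And>y. y \<in> carrier Y \<Longrightarrow> u (c y) = t y"
proof
  interpret Y: module R Y by fact
  let ?u = "restrict (\<lambda>z. t (inv_into (carrier Y) c z)) (carrier Q)"
  have uc: "?u (c y) = t y" if y: "y \<in> carrier Y" for y
  proof -
    let ?y' = "inv_into (carrier Y) c (c y)"
    have y': "?y' \<in> carrier Y" "c ?y' = c y"
      using y by (auto simp: f_inv_into_f inv_into_into)
    have "t ?y' = t y"
      using ker[of "?y' \<ominus>\<^bsub>Y\<^esub> y"] mod_hom_eq_iff[OF assms(1,2) c y'(1) y] y'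
        mod_hom_eq_iff[OF assms(1,3) t y'(1) y] y
      by simp
    then show ?thesis using mod_hom_closed[OF c y] by simp
  qed
  show "?u (c y) = t y" if "y \<in> carrier Y" for y using uc that .
  show "?u \<in> mod_hom R Q T"
  proof (rule mod_homI)
    fix z assume "z \<in> carrier Q"
    then obtain y where y: "y \<in> carrier Y" "z = c y" using surj by auto
    then show "?u z \<in> carrier T" using uc mod_hom_closed[OF t] by metis
    fix w assume "w \<in> carrier Q"
    then obtain x where x: "x \<in> carrier Y" "w = c x" using surj by auto
    show "?u (z \<oplus>\<^bsub>Q\<^esub> w) = ?u z \<oplus>\<^bsub>T\<^esub> ?u w"
      unfolding x y mod_hom_add[OF c y(1) x(1), symmetric]
      using uc x y mod_hom_add[OF t y(1) x(1)] by (simp del: restrict_apply)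
  next
    fix r z assume r: "r \<in> carrier R" and "z \<in> carrier Q"
    then obtain y where y: "y \<in> carrier Y" "z = c y" using surj by auto
    show "?u (r \<odot>\<^bsub>Q\<^esub> z) = r \<odot>\<^bsub>T\<^esub> ?u z"
      unfolding y mod_hom_smult[OF c r y(1), symmetric]
      using uc r y mod_hom_smult[OF t r y(1)] by (simp del: restrict_apply)
  qed simp
qed


section \<open>Submodules and quotient modules\<close>

lemma submoduleD:
  assumes "module R M" "submodule H R M"
  shows submodule_zero: "\<zero>\<^bsub>M\<^esub> \<in> H"
    and submodule_add: "\<And>x y. \<lbrakk>x \<in> H; y \<in> H\<rbrakk> \<Longrightarrow> x \<oplus>\<^bsub>M\<^esub> y \<in> H"
    and submodule_minus: "\<And>x. x \<in> H \<Longrightarrow> \<ominus>\<^bsub>M\<^esub> x \<in> H"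
    and submodule_smult: "\<And>r x. \<lbrakk>r \<in> carrier R; x \<in> H\<rbrakk> \<Longrightarrow> r \<odot>\<^bsub>M\<^esub> x \<in> H"
  using module.submoduleE[OF assms] subgroup.one_closed[OF submodule.axioms(1)[OF assms(2)]]
  by auto

text \<open>
  Two homomorphisms agree everywhere as soon as they agree on generators, because their equalizer is a
  submodule.
\<close>

lemma equalizer_submodule:
  assumes "module R M" "module R N" "f \<in> mod_hom R M N" "g \<in> mod_hom R M N"
  shows "submodule {x \<in> carrier M. f x = g x} R M"
proof -
  interpret M: module R M by fact
  show ?thesis
    by (rule M.submoduleI)
      (use assms in \<open>auto simp: mod_hom_zero mod_hom_minus mod_hom_add mod_hom_smult\<close>)
qed

lemma kernel_submodule:
  assumes "module R M" "module R N" "f \<in> mod_hom R M N"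
  shows "submodule {x \<in> carrier M. f x = \<zero>\<^bsub>N\<^esub>} R M"
proof -
  interpret M: module R M by fact
  interpret N: module R N by fact
  show ?thesis
    by (rule M.submoduleI)
      (use assms in \<open>auto simp: mod_hom_zero mod_hom_minus mod_hom_add mod_hom_smult\<close>)
qed

lemma image_submodule:
  assumes "module R M" "module R N" "f \<in> mod_hom R M N"
  shows "submodule (f ` carrier M) R N"
proof -
  interpret M: module R M by fact
  interpret N: module R N by fact
  show ?thesis
  proof (rule N.submoduleI)
    show "\<zero>\<^bsub>N\<^esub> \<in> f ` carrier M" using mod_hom_zero[OF assms] by (metis M.M.zero_closed imageI)
  next
    fix a assume "a \<in> f ` carrier M"
    then obtain x where "x \<in> carrier M" "a = f x" by auto
    then show "\<ominus>\<^bsub>N\<^esub> a \<in> f ` carrier M"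
      using mod_hom_minus[OF assms, of x] by (metis M.M.a_inv_closed imageI)
  next
    fix a b assume "a \<in> f ` carrier M" "b \<in> f ` carrier M"
    then obtain x y where "x \<in> carrier M" "a = f x" "y \<in> carrier M" "b = f y" by auto
    then show "a \<oplus>\<^bsub>N\<^esub> b \<in> f ` carrier M"
      using mod_hom_add[OF assms(3), of x y] by (metis M.M.a_closed imageI)
  next
    fix a x assume "a \<in> carrier R" "x \<in> f ` carrier M"
    then obtain y where "y \<in> carrier M" "x = f y" by auto
    then show "a \<odot>\<^bsub>N\<^esub> x \<in> f ` carrier M"
      using mod_hom_smult[OF assms(3) \<open>a \<in> carrier R\<close>, of y] \<open>a \<in> carrier R\<close>
      by (metis M.smult_closed imageI)
  qed (use mod_hom_closed[OF assms(3)] in auto)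
qed

lemma submodule_generated_subset: "S \<subseteq> submodule_generated R M S"
  by (auto simp: submodule_generated_def)

lemma submodule_generated_least:
  "\<lbrakk>submodule H R M; S \<subseteq> H\<rbrakk> \<Longrightarrow> submodule_generated R M S \<subseteq> H"
  by (auto simp: submodule_generated_def)

lemma submodule_generated_submodule:
  assumes "module R M" "S \<subseteq> carrier M"
  shows "submodule (submodule_generated R M S) R M"
proof -
  interpret M: module R M by fact
  have "submodule (carrier M) R M" by (rule M.carrier_is_submodule)
  then have "submodule_generated R M S \<subseteq> carrier M"
    using assms(2) by (rule submodule_generated_least)
  then show ?thesis
    by (intro M.submoduleI)
      (auto simp: submodule_generated_def submodule_zero[OF assms(1)] submodule_add[OF assms(1)]
        submodule_minus[OF assms(1)] submodule_smult[OF assms(1)])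
qed

lemma submodule_abelian_subgroup:
  assumes "module R M" "submodule H R M"
  shows "abelian_subgroup H M"
  using assms by (intro abelian_subgroupI3 additive_subgroupI submodule.axioms(1) module.axioms(2))

lemma coset_eq_iff:
  assumes "module R M" "submodule H R M" "x \<in> carrier M" "y \<in> carrier M"
  shows "H +>\<^bsub>M\<^esub> x = H +>\<^bsub>M\<^esub> y \<longleftrightarrow> x \<ominus>\<^bsub>M\<^esub> y \<in> H"
proof -
  interpret M: module R M by fact
  interpret H: abelian_subgroup H M by (rule submodule_abelian_subgroup[OF assms(1,2)])
  let ?d = "x \<ominus>\<^bsub>M\<^esub> y"
  have d: "?d \<in> carrier M" using assms by simp
  have "H +>\<^bsub>M\<^esub> ?d = H \<longleftrightarrow> ?d \<in> H"
    using M.M.a_coset_join1[OF _ d H.a_subgroup] M.M.a_coset_join2[OF d H.a_subgroup] by blast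
  moreover have "H +>\<^bsub>M\<^esub> x = H +>\<^bsub>M\<^esub> y \<longleftrightarrow> H +>\<^bsub>M\<^esub> ?d = H"
    using M.M.a_coset_add_inv1[OF _ assms(3,4) H.a_subset]
      M.M.a_coset_add_inv2[OF _ assms(3,4) H.a_subset]
    unfolding a_minus_def by blast
  ultimately show ?thesis by simp
qed

text \<open>
  The scalar multiplication of \<^const>\<open>quot_module\<close> is a union over all representatives of a coset. Each of them
  yields the same coset, so it can be computed on any one of them.
\<close>

lemma quot_smult_coset:
  assumes "module R M" "submodule H R M" "r \<in> carrier R" "x \<in> carrier M"
  shows "r \<odot>\<^bsub>quot_module M H\<^esub> (H +>\<^bsub>M\<^esub> x) = H +>\<^bsub>M\<^esub> (r \<odot>\<^bsub>M\<^esub> x)"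
proof -
  interpret M: module R M by fact
  interpret H: abelian_subgroup H M by (rule submodule_abelian_subgroup[OF assms(1,2)])
  have "H +>\<^bsub>M\<^esub> (r \<odot>\<^bsub>M\<^esub> y) = H +>\<^bsub>M\<^esub> (r \<odot>\<^bsub>M\<^esub> x)" if "y \<in> H +>\<^bsub>M\<^esub> x" for y
  proof -
    have y: "y \<in> carrier M" using that M.M.a_r_coset_subset_G[OF H.a_subset assms(4)] by auto
    have "H +>\<^bsub>M\<^esub> x = H +>\<^bsub>M\<^esub> y" by (rule M.M.a_repr_independence[OF that assms(4) H.a_subgroup])
    then have "y \<ominus>\<^bsub>M\<^esub> x \<in> H" using coset_eq_iff[OF assms(1,2) y assms(4)] by simp
    then have "r \<odot>\<^bsub>M\<^esub> (y \<ominus>\<^bsub>M\<^esub> x) \<in> H" using submodule_smult[OF assms(1,2,3)] by simp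
    moreover have "r \<odot>\<^bsub>M\<^esub> (y \<ominus>\<^bsub>M\<^esub> x) = r \<odot>\<^bsub>M\<^esub> y \<ominus>\<^bsub>M\<^esub> r \<odot>\<^bsub>M\<^esub> x"
      using assms(3,4) y by (simp add: a_minus_def M.smult_r_distr M.smult_r_minus)
    ultimately show ?thesis using coset_eq_iff[OF assms(1,2)] y assms(3,4) by simp
  qed
  moreover have "x \<in> H +>\<^bsub>M\<^esub> x" by (rule H.a_rcos_self[OF assms(4)])
  ultimately have "(\<Union>y\<in>H +>\<^bsub>M\<^esub> x. H +>\<^bsub>M\<^esub> (r \<odot>\<^bsub>M\<^esub> y)) = H +>\<^bsub>M\<^esub> (r \<odot>\<^bsub>M\<^esub> x)" by blast
  then show ?thesis by (simp only: quot_module_def module.simps)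
qed

lemma quot_module:
  assumes "module R M" "submodule H R M"
  shows quot_module_module: "module R (quot_module M H)"
    and coset_mod_hom: "restrict (\<lambda>x. H +>\<^bsub>M\<^esub> x) (carrier M) \<in> mod_hom R M (quot_module M H)"
    and carrier_quot_module: "carrier (quot_module M H) = (\<lambda>x. H +>\<^bsub>M\<^esub> x) ` carrier M"
    and coset_zero_iff: "\<And>x. x \<in> carrier M \<Longrightarrow> H +>\<^bsub>M\<^esub> x = \<zero>\<^bsub>quot_module M H\<^esub> \<longleftrightarrow> x \<in> H"
proof -
  interpret M: module R M by fact
  interpret H: abelian_subgroup H M by (rule submodule_abelian_subgroup[OF assms(1,2)])
  let ?Q = "quot_module M H"
  show carr: "carrier ?Q = (\<lambda>x. H +>\<^bsub>M\<^esub> x) ` carrier M"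
    by (auto simp: quot_module_def A_RCOSETS_def')
  have add: "(H +>\<^bsub>M\<^esub> x) \<oplus>\<^bsub>?Q\<^esub> (H +>\<^bsub>M\<^esub> y) = H +>\<^bsub>M\<^esub> (x \<oplus>\<^bsub>M\<^esub> y)"
    if "x \<in> carrier M" "y \<in> carrier M" for x y
    using H.a_rcos_sum[OF that] by (simp add: quot_module_def)
  show mod: "module R ?Q"
    by (rule module_surj_image[OF assms(1) carr add quot_smult_coset[OF assms]])
      (simp_all add: quot_module_def H.a_subset)
  show "restrict (\<lambda>x. H +>\<^bsub>M\<^esub> x) (carrier M) \<in> mod_hom R M ?Q"
    by (rule mod_homI) (simp_all add: carr add quot_smult_coset[OF assms])
  show "H +>\<^bsub>M\<^esub> x = \<zero>\<^bsub>?Q\<^esub> \<longleftrightarrow> x \<in> H" if "x \<in> carrier M" for x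
    using M.M.a_coset_join1[OF _ that H.a_subgroup] M.M.a_coset_join2[OF that H.a_subgroup]
    by (simp add: quot_module_def) blast
qed


section \<open>Free modules\<close>

lemma free_module_carrierD:
  assumes "u \<in> carrier (free_module R S)"
  shows "u p \<in> carrier R" "finite {p. u p \<noteq> \<zero>\<^bsub>R\<^esub>}" "{p. u p \<noteq> \<zero>\<^bsub>R\<^esub>} \<subseteq> S"
  using assms by (auto simp: free_module_def)

lemma free_module_carrierI:
  assumes "\<And>p. u p \<in> carrier R" "finite B" "B \<subseteq> S" "\<And>p. p \<notin> B \<Longrightarrow> u p = \<zero>\<^bsub>R\<^esub>"
  shows "u \<in> carrier (free_module R S)"
proof -
  have "{p. u p \<noteq> \<zero>\<^bsub>R\<^esub>} \<subseteq> B" using assms(4) by auto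
  then show ?thesis using assms(1-3) by (auto simp: free_module_def intro: finite_subset)
qed

lemma free_module_ops:
  "\<zero>\<^bsub>free_module R S\<^esub> = (\<lambda>p. \<zero>\<^bsub>R\<^esub>)"
  "u \<oplus>\<^bsub>free_module R S\<^esub> v = (\<lambda>p. u p \<oplus>\<^bsub>R\<^esub> v p)"
  "r \<odot>\<^bsub>free_module R S\<^esub> u = (\<lambda>p. r \<otimes>\<^bsub>R\<^esub> u p)"
  by (simp_all add: free_module_def)

lemma free_module_module:
  assumes "cring R"
  shows "module R (free_module R S)"
proof -
  interpret cring R by fact
  let ?F = "free_module R S"
  note D = free_module_carrierD
  have add: "u \<oplus>\<^bsub>?F\<^esub> v \<in> carrier ?F" if "u \<in> carrier ?F" "v \<in> carrier ?F" for u v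
    by (rule free_module_carrierI[where B = "{p. u p \<noteq> \<zero>\<^bsub>R\<^esub>} \<union> {p. v p \<noteq> \<zero>\<^bsub>R\<^esub>}"])
      (use D[OF that(1)] D[OF that(2)] in \<open>auto simp: free_module_ops\<close>)
  have smult: "r \<odot>\<^bsub>?F\<^esub> u \<in> carrier ?F" if "r \<in> carrier R" "u \<in> carrier ?F" for r u
    by (rule free_module_carrierI[where B = "{p. u p \<noteq> \<zero>\<^bsub>R\<^esub>}"])
      (use D[OF that(2)] that(1) in \<open>auto simp: free_module_ops\<close>)
  show ?thesis
  proof (rule moduleI)
    show "abelian_group ?F"
    proof (rule abelian_groupI)
      show "\<zero>\<^bsub>?F\<^esub> \<in> carrier ?F"
        by (rule free_module_carrierI[where B = "{}"]) (auto simp: free_module_ops)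
      fix u assume u: "u \<in> carrier ?F"
      have "(\<ominus>\<^bsub>R\<^esub> \<one>\<^bsub>R\<^esub>) \<odot>\<^bsub>?F\<^esub> u \<oplus>\<^bsub>?F\<^esub> u = \<zero>\<^bsub>?F\<^esub>"
        using D(1)[OF u] by (simp add: free_module_ops l_minus l_neg)
      then show "\<exists>v\<in>carrier ?F. v \<oplus>\<^bsub>?F\<^esub> u = \<zero>\<^bsub>?F\<^esub>" using smult[OF _ u] by blast
    next
      fix u v w assume "u \<in> carrier ?F" "v \<in> carrier ?F" "w \<in> carrier ?F"
      then show "u \<oplus>\<^bsub>?F\<^esub> v \<oplus>\<^bsub>?F\<^esub> w = u \<oplus>\<^bsub>?F\<^esub> (v \<oplus>\<^bsub>?F\<^esub> w)"
        by (simp add: free_module_ops D(1) a_assoc)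
    next
      fix u v assume "u \<in> carrier ?F" "v \<in> carrier ?F"
      then show "u \<oplus>\<^bsub>?F\<^esub> v = v \<oplus>\<^bsub>?F\<^esub> u" by (simp add: free_module_ops D(1) a_comm)
    next
      fix u assume "u \<in> carrier ?F"
      then show "\<zero>\<^bsub>?F\<^esub> \<oplus>\<^bsub>?F\<^esub> u = u" by (simp add: free_module_ops D(1))
    qed (rule add)
  next
    fix a b u v assume "a \<in> carrier R" "b \<in> carrier R" "u \<in> carrier ?F" "v \<in> carrier ?F"
    then show "(a \<oplus>\<^bsub>R\<^esub> b) \<odot>\<^bsub>?F\<^esub> u = a \<odot>\<^bsub>?F\<^esub> u \<oplus>\<^bsub>?F\<^esub> b \<odot>\<^bsub>?F\<^esub> u"
      and "a \<odot>\<^bsub>?F\<^esub> (u \<oplus>\<^bsub>?F\<^esub> v) = a \<odot>\<^bsub>?F\<^esub> u \<oplus>\<^bsub>?F\<^esub> a \<odot>\<^bsub>?F\<^esub> v"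
      and "(a \<otimes>\<^bsub>R\<^esub> b) \<odot>\<^bsub>?F\<^esub> u = a \<odot>\<^bsub>?F\<^esub> (b \<odot>\<^bsub>?F\<^esub> u)"
      by (simp_all add: free_module_ops D(1) l_distr r_distr m_assoc)
  next
    fix u assume "u \<in> carrier ?F"
    then show "\<one>\<^bsub>R\<^esub> \<odot>\<^bsub>?F\<^esub> u = u" by (simp add: free_module_ops D(1))
  qed (auto intro: smult is_cring)
qed

lemma free_gen_closed:
  assumes "cring R" "p \<in> S"
  shows "free_gen R p \<in> carrier (free_module R S)"
proof -
  interpret cring R by fact
  show ?thesis
    by (rule free_module_carrierI[where B = "{p}"]) (use assms in \<open>auto simp: free_gen_def\<close>)
qed

text \<open>
  Induction on a finite set containing the support: a vector is the sum of the vector with one entry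
  erased and a multiple of a generator.
\<close>

lemma free_module_generated:
  assumes "cring R" and H: "submodule H R (free_module R S)"
    and gens: "\<And>p. p \<in> S \<Longrightarrow> free_gen R p \<in> H"
    and u: "u \<in> carrier (free_module R S)"
  shows "u \<in> H"
proof -
  interpret cring R by fact
  let ?F = "free_module R S"
  note F = free_module_module[OF assms(1), of S]
  have "v \<in> H" if "finite B" "v \<in> carrier ?F" "{p. v p \<noteq> \<zero>\<^bsub>R\<^esub>} \<subseteq> B" "B \<subseteq> S" for B v
    using that
  proof (induction B arbitrary: v rule: finite_induct)
    case empty
    then have "v = \<zero>\<^bsub>?F\<^esub>" by (auto simp: free_module_ops)
    then show ?case using submodule_zero[OF F H] by simp
  next
    case (insert q B)
    note v = free_module_carrierD[OF insert.prems(1)]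
    let ?w = "v(q := \<zero>\<^bsub>R\<^esub>)"
    have w: "?w \<in> carrier ?F"
      by (rule free_module_carrierI[where B = B]) (use v insert in auto)
    have "?w \<in> H" by (rule insert.IH[OF w]) (use insert.prems in auto)
    moreover have "v q \<odot>\<^bsub>?F\<^esub> free_gen R q \<in> H"
      using submodule_smult[OF F H v(1)] gens insert.prems by simp
    moreover have "v = ?w \<oplus>\<^bsub>?F\<^esub> v q \<odot>\<^bsub>?F\<^esub> free_gen R q"
      using v(1) by (auto simp: free_module_ops free_gen_def)
    ultimately show ?case using submodule_add[OF F H] by metis
  qed
  then show ?thesis using free_module_carrierD[OF u] u by blast
qed

text \<open>
  The extension sends \<open>u\<close> to the sum of \<open>u p \<odot> \<beta> p\<close> over the support of \<open>u\<close>. Additivity needs the sums for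
  \<open>u\<close>, \<open>v\<close> and \<open>u \<oplus> v\<close> over a common index set; enlarging the support only adds zero terms.
\<close>

lemma free_module_lift:
  assumes "cring R" "module R N" and \<beta>: "\<And>p. p \<in> S \<Longrightarrow> \<beta> p \<in> carrier N"
  obtains h where "h \<in> mod_hom R (free_module R S) N" "\<And>p. p \<in> S \<Longrightarrow> h (free_gen R p) = \<beta> p"
proof
  interpret cring R by fact
  interpret N: module R N by fact
  let ?F = "free_module R S"
  interpret F: module R ?F by (rule free_module_module[OF assms(1)])
  let ?s = "\<lambda>u. {p. u p \<noteq> \<zero>\<^bsub>R\<^esub>}"
  let ?h = "restrict (\<lambda>u. \<Oplus>\<^bsub>N\<^esub>p\<in>?s u. u p \<odot>\<^bsub>N\<^esub> \<beta> p) (carrier ?F)"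
  note D = free_module_carrierD
  have h_eq: "?h u = (\<Oplus>\<^bsub>N\<^esub>p\<in>B. u p \<odot>\<^bsub>N\<^esub> \<beta> p)"
    if "u \<in> carrier ?F" "finite B" "?s u \<subseteq> B" "B \<subseteq> S" for u B
  proof -
    have "(\<Oplus>\<^bsub>N\<^esub>p\<in>?s u. u p \<odot>\<^bsub>N\<^esub> \<beta> p) = (\<Oplus>\<^bsub>N\<^esub>p\<in>B. u p \<odot>\<^bsub>N\<^esub> \<beta> p)"
      by (rule N.M.add.finprod_mono_neutral_cong_left) (use that \<beta> D(1)[OF that(1)] in auto)
    then show ?thesis using that(1) by simp
  qed
  show "?h \<in> mod_hom R ?F N"
  proof (rule mod_homI)
    fix u assume u: "u \<in> carrier ?F"
    then show "?h u \<in> carrier N"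
      using D[OF u] \<beta> by (auto intro!: N.M.finsum_closed)
    fix v assume v: "v \<in> carrier ?F"
    let ?B = "?s u \<union> ?s v"
    have B: "finite ?B" "?B \<subseteq> S" using D[OF u] D[OF v] by auto
    have s: "?s (u \<oplus>\<^bsub>?F\<^esub> v) \<subseteq> ?B" by (auto simp: free_module_ops)
    have "?h (u \<oplus>\<^bsub>?F\<^esub> v) = (\<Oplus>\<^bsub>N\<^esub>p\<in>?B. (u p \<oplus>\<^bsub>R\<^esub> v p) \<odot>\<^bsub>N\<^esub> \<beta> p)"
      using h_eq[OF F.M.a_closed[OF u v] B(1) s B(2)] by (simp only: free_module_ops)
    also have "\<dots> = (\<Oplus>\<^bsub>N\<^esub>p\<in>?B. u p \<odot>\<^bsub>N\<^esub> \<beta> p \<oplus>\<^bsub>N\<^esub> v p \<odot>\<^bsub>N\<^esub> \<beta> p)"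
      by (rule N.M.finsum_cong') (use B(2) D(1)[OF u] D(1)[OF v] \<beta> in \<open>auto simp: N.smult_l_distr\<close>)
    also have "\<dots> = (\<Oplus>\<^bsub>N\<^esub>p\<in>?B. u p \<odot>\<^bsub>N\<^esub> \<beta> p) \<oplus>\<^bsub>N\<^esub> (\<Oplus>\<^bsub>N\<^esub>p\<in>?B. v p \<odot>\<^bsub>N\<^esub> \<beta> p)"
      by (rule N.M.finsum_addf) (use B(2) D(1)[OF u] D(1)[OF v] \<beta> in auto)
    also have "\<dots> = ?h u \<oplus>\<^bsub>N\<^esub> ?h v"
      using h_eq[OF u B(1) _ B(2)] h_eq[OF v B(1) _ B(2)] by simp
    finally show "?h (u \<oplus>\<^bsub>?F\<^esub> v) = ?h u \<oplus>\<^bsub>N\<^esub> ?h v" .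
  next
    fix r u assume r: "r \<in> carrier R" and u: "u \<in> carrier ?F"
    note d = D[OF u]
    have s: "?s (r \<odot>\<^bsub>?F\<^esub> u) \<subseteq> ?s u" using r by (auto simp: free_module_ops)
    have "?h (r \<odot>\<^bsub>?F\<^esub> u) = (\<Oplus>\<^bsub>N\<^esub>p\<in>?s u. (r \<otimes>\<^bsub>R\<^esub> u p) \<odot>\<^bsub>N\<^esub> \<beta> p)"
      using h_eq[OF F.smult_closed[OF r u] d(2) s d(3)] by (simp only: free_module_ops)
    also have "\<dots> = (\<Oplus>\<^bsub>N\<^esub>p\<in>?s u. r \<odot>\<^bsub>N\<^esub> (u p \<odot>\<^bsub>N\<^esub> \<beta> p))"
      by (rule N.M.finsum_cong') (use d(1,3) \<beta> r in \<open>auto simp: N.smult_assoc1\<close>)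
    also have "\<dots> = r \<odot>\<^bsub>N\<^esub> ?h u"
      using u by (subst N.finsum_smult_ldistr[symmetric]) (use d \<beta> r in auto)
    finally show "?h (r \<odot>\<^bsub>?F\<^esub> u) = r \<odot>\<^bsub>N\<^esub> ?h u" .
  qed simp
  fix p assume p: "p \<in> S"
  have "?h (free_gen R p) = (\<Oplus>\<^bsub>N\<^esub>q\<in>{p}. free_gen R p q \<odot>\<^bsub>N\<^esub> \<beta> q)"
    by (rule h_eq) (use p free_gen_closed[OF assms(1)] in \<open>auto simp: free_gen_def\<close>)
  then show "?h (free_gen R p) = \<beta> p"
    using \<beta>[OF p] by (simp add: free_gen_def)
qed


section \<open>Tensor products\<close>

lemma tensor_relations:
  assumes "module R M" "module R N"
  shows tensor_relations_submodule:
      "submodule (tensor_relations R M N) R (free_module R (carrier M \<times> carrier N))"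
    and tensor_relation_add_left:
      "\<And>m m' n. \<lbrakk>m \<in> carrier M; m' \<in> carrier M; n \<in> carrier N\<rbrakk> \<Longrightarrow>
        free_gen R (m \<oplus>\<^bsub>M\<^esub> m', n) \<ominus>\<^bsub>free_module R (carrier M \<times> carrier N)\<^esub>
        (free_gen R (m, n) \<oplus>\<^bsub>free_module R (carrier M \<times> carrier N)\<^esub> free_gen R (m', n))
        \<in> tensor_relations R M N"
    and tensor_relation_add_right:
      "\<And>m n n'. \<lbrakk>m \<in> carrier M; n \<in> carrier N; n' \<in> carrier N\<rbrakk> \<Longrightarrow>
        free_gen R (m, n \<oplus>\<^bsub>N\<^esub> n') \<ominus>\<^bsub>free_module R (carrier M \<times> carrier N)\<^esub>
        (free_gen R (m, n) \<oplus>\<^bsub>free_module R (carrier M \<times> carrier N)\<^esub> free_gen R (m, n'))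
        \<in> tensor_relations R M N"
    and tensor_relation_smult_left:
      "\<And>r m n. \<lbrakk>r \<in> carrier R; m \<in> carrier M; n \<in> carrier N\<rbrakk> \<Longrightarrow>
        free_gen R (r \<odot>\<^bsub>M\<^esub> m, n) \<ominus>\<^bsub>free_module R (carrier M \<times> carrier N)\<^esub>
        r \<odot>\<^bsub>free_module R (carrier M \<times> carrier N)\<^esub> free_gen R (m, n) \<in> tensor_relations R M N"
    and tensor_relation_smult_right:
      "\<And>r m n. \<lbrakk>r \<in> carrier R; m \<in> carrier M; n \<in> carrier N\<rbrakk> \<Longrightarrow>
        free_gen R (m, r \<odot>\<^bsub>N\<^esub> n) \<ominus>\<^bsub>free_module R (carrier M \<times> carrier N)\<^esub>
        r \<odot>\<^bsub>free_module R (carrier M \<times> carrier N)\<^esub> free_gen R (m, n) \<in> tensor_relations R M N"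
proof -
  interpret M: module R M by fact
  interpret N: module R N by fact
  let ?F = "free_module R (carrier M \<times> carrier N)"
  interpret F: module R ?F by (rule free_module_module[OF M.R.is_cring])
  have e: "free_gen R (m, n) \<in> carrier ?F" if "m \<in> carrier M" "n \<in> carrier N" for m n
    by (rule free_gen_closed[OF M.R.is_cring]) (use that in auto)
  show "submodule (tensor_relations R M N) R ?F"
    unfolding tensor_relations_def Let_def
    by (rule submodule_generated_submodule[OF F.module_axioms])
      (auto intro!: F.M.minus_closed F.M.a_closed F.smult_closed e)
qed (unfold tensor_relations_def Let_def, (rule subsetD[OF submodule_generated_subset], blast)+)


lemma tensor_module_module: "\<lbrakk>module R M; module R N\<rbrakk> \<Longrightarrow> module R (tensor_module R M N)"
  unfolding tensor_module_def
  by (intro quot_module_module free_module_module tensor_relations_submodule) (rule module.axioms)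

context
  fixes R :: "('r, 'x) ring_scheme" and M :: "('r, 'm, 'y) module_scheme"
    and N :: "('r, 'n, 'z) module_scheme"
  assumes M: "module R M" and N: "module R N"
begin

lemmas tensor_coset_hom = coset_mod_hom[OF free_module_module[OF module.axioms(1)[OF M]]
  tensor_relations_submodule[OF M N], folded tensor_module_def]

lemmas carrier_tensor_module = carrier_quot_module[OF free_module_module[OF module.axioms(1)[OF M]]
  tensor_relations_submodule[OF M N], folded tensor_module_def]

lemmas tensor_coset_zero_iff = coset_zero_iff[OF free_module_module[OF module.axioms(1)[OF M]]
  tensor_relations_submodule[OF M N], folded tensor_module_def]

lemmas tensor_coset_eq_iff = coset_eq_iff[OF free_module_module[OF module.axioms(1)[OF M]]
  tensor_relations_submodule[OF M N]]

end

text \<open>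
  Bilinearity of \<open>m \<otimes> n\<close>: each of the four families of generators of \<^const>\<open>tensor_relations\<close> becomes an
  equation between cosets.
\<close>

lemma pure_tensor:
  assumes "module R M" "module R N"
  shows pure_tensor_closed:
      "\<And>m n. \<lbrakk>m \<in> carrier M; n \<in> carrier N\<rbrakk> \<Longrightarrow> pure_tensor R M N m n \<in> carrier (tensor_module R M N)"
    and pure_tensor_add_left:
      "\<And>m m' n. \<lbrakk>m \<in> carrier M; m' \<in> carrier M; n \<in> carrier N\<rbrakk> \<Longrightarrow>
        pure_tensor R M N (m \<oplus>\<^bsub>M\<^esub> m') n
        = pure_tensor R M N m n \<oplus>\<^bsub>tensor_module R M N\<^esub> pure_tensor R M N m' n"
    and pure_tensor_add_right:
      "\<And>m n n'. \<lbrakk>m \<in> carrier M; n \<in> carrier N; n' \<in> carrier N\<rbrakk> \<Longrightarrow>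
        pure_tensor R M N m (n \<oplus>\<^bsub>N\<^esub> n')
        = pure_tensor R M N m n \<oplus>\<^bsub>tensor_module R M N\<^esub> pure_tensor R M N m n'"
    and pure_tensor_smult_left:
      "\<And>r m n. \<lbrakk>r \<in> carrier R; m \<in> carrier M; n \<in> carrier N\<rbrakk> \<Longrightarrow>
        pure_tensor R M N (r \<odot>\<^bsub>M\<^esub> m) n = r \<odot>\<^bsub>tensor_module R M N\<^esub> pure_tensor R M N m n"
    and pure_tensor_smult_right:
      "\<And>r m n. \<lbrakk>r \<in> carrier R; m \<in> carrier M; n \<in> carrier N\<rbrakk> \<Longrightarrow>
        pure_tensor R M N m (r \<odot>\<^bsub>N\<^esub> n) = r \<odot>\<^bsub>tensor_module R M N\<^esub> pure_tensor R M N m n"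
proof -
  interpret M: module R M by fact
  interpret N: module R N by fact
  let ?F = "free_module R (carrier M \<times> carrier N)" and ?H = "tensor_relations R M N"
  interpret F: module R ?F by (rule free_module_module[OF M.R.is_cring])
  let ?T = "tensor_module R M N" and ?q = "\<lambda>u. ?H +>\<^bsub>?F\<^esub> u"
  have e: "free_gen R (m, n) \<in> carrier ?F" if "m \<in> carrier M" "n \<in> carrier N" for m n
    by (rule free_gen_closed[OF M.R.is_cring]) (use that in auto)
  have q: "?q u \<oplus>\<^bsub>?T\<^esub> ?q v = ?q (u \<oplus>\<^bsub>?F\<^esub> v)" "r \<odot>\<^bsub>?T\<^esub> ?q u = ?q (r \<odot>\<^bsub>?F\<^esub> u)"
    if "u \<in> carrier ?F" "v \<in> carrier ?F" "r \<in> carrier R" for u v r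
    using mod_hom_add[OF tensor_coset_hom[OF assms] that(1,2)]
      mod_hom_smult[OF tensor_coset_hom[OF assms] that(3,1)] that by simp_all
  show "pure_tensor R M N m n \<in> carrier ?T" if "m \<in> carrier M" "n \<in> carrier N" for m n
    using e[OF that] by (simp add: pure_tensor_def carrier_tensor_module[OF assms])
  show "pure_tensor R M N (m \<oplus>\<^bsub>M\<^esub> m') n = pure_tensor R M N m n \<oplus>\<^bsub>?T\<^esub> pure_tensor R M N m' n"
    if "m \<in> carrier M" "m' \<in> carrier M" "n \<in> carrier N" for m m' n
    using tensor_relation_add_left[OF assms that] that
    by (simp add: pure_tensor_def q[OF _ _ M.R.zero_closed] e tensor_coset_eq_iff[OF assms])
  show "pure_tensor R M N m (n \<oplus>\<^bsub>N\<^esub> n') = pure_tensor R M N m n \<oplus>\<^bsub>?T\<^esub> pure_tensor R M N m n'"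
    if "m \<in> carrier M" "n \<in> carrier N" "n' \<in> carrier N" for m n n'
    using tensor_relation_add_right[OF assms that] that
    by (simp add: pure_tensor_def q[OF _ _ M.R.zero_closed] e tensor_coset_eq_iff[OF assms])
  show "pure_tensor R M N (r \<odot>\<^bsub>M\<^esub> m) n = r \<odot>\<^bsub>?T\<^esub> pure_tensor R M N m n"
    and "pure_tensor R M N m (r \<odot>\<^bsub>N\<^esub> n) = r \<odot>\<^bsub>?T\<^esub> pure_tensor R M N m n"
    if "r \<in> carrier R" "m \<in> carrier M" "n \<in> carrier N" for r m n
    using tensor_relation_smult_left[OF assms that] tensor_relation_smult_right[OF assms that] that
    by (simp_all add: pure_tensor_def q[OF _ F.M.zero_closed] e tensor_coset_eq_iff[OF assms])
qed

lemma tensor_module_generated: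
  assumes "module R M" "module R N" and H: "submodule H R (tensor_module R M N)"
    and pure: "\<And>m n. \<lbrakk>m \<in> carrier M; n \<in> carrier N\<rbrakk> \<Longrightarrow> pure_tensor R M N m n \<in> H"
    and z: "z \<in> carrier (tensor_module R M N)"
  shows "z \<in> H"
proof -
  interpret M: module R M by fact
  let ?F = "free_module R (carrier M \<times> carrier N)"
  let ?q = "restrict (\<lambda>u. tensor_relations R M N +>\<^bsub>?F\<^esub> u) (carrier ?F)"
  interpret F: module R ?F by (rule free_module_module[OF M.R.is_cring])
  note T = tensor_module_module[OF assms(1,2)]
  note q = tensor_coset_hom[OF assms(1,2)]
  have "submodule {u \<in> carrier ?F. ?q u \<in> H} R ?F"
    by (rule F.submoduleI)
      (auto simp: mod_hom_zero[OF F.module_axioms T q] mod_hom_minus[OF F.module_axioms T q]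
        mod_hom_add[OF q] mod_hom_smult[OF q] submodule_zero[OF T H] submodule_minus[OF T H]
        submodule_add[OF T H] submodule_smult[OF T H] simp del: restrict_apply)
  moreover have "free_gen R p \<in> {u \<in> carrier ?F. ?q u \<in> H}" if "p \<in> carrier M \<times> carrier N" for p
    using that pure free_gen_closed[OF M.R.is_cring that] by (auto simp: pure_tensor_def)
  ultimately have "u \<in> {u \<in> carrier ?F. ?q u \<in> H}" if "u \<in> carrier ?F" for u
    using that by (rule free_module_generated[OF M.R.is_cring])
  then show ?thesis using z by (auto simp: carrier_tensor_module[OF assms(1,2)])
qed

lemma tensor_hom_eqI:
  assumes "module R M" "module R N" "module R P"
    and "h \<in> mod_hom R (tensor_module R M N) P" "h' \<in> mod_hom R (tensor_module R M N) P"
    and "\<And>m n. \<lbrakk>m \<in> carrier M; n \<in> carrier N\<rbrakk>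
      \<Longrightarrow> h (pure_tensor R M N m n) = h' (pure_tensor R M N m n)"
  shows "h = h'"
  using assms(4,5)
proof (rule mod_hom_eqI)
  fix z assume z: "z \<in> carrier (tensor_module R M N)"
  have "z \<in> {x \<in> carrier (tensor_module R M N). h x = h' x}"
    by (rule tensor_module_generated[OF assms(1,2)
        equalizer_submodule[OF tensor_module_module[OF assms(1,2)] assms(3,4,5)] _ z])
      (simp_all add: assms(6) pure_tensor_closed[OF assms(1,2)])
  then show "h z = h' z" by simp
qed

text \<open>
  The universal property. A bilinear map extends to the free module on the pairs, and its bilinearity says
  that the extension vanishes on the generators of the relations.
\<close>

lemma tensor_lift:
  assumes "module R M" "module R N" "module R P"
    and closed: "\<And>m n. \<lbrakk>m \<in> carrier M; n \<in> carrier N\<rbrakk> \<Longrightarrow> \<beta> m n \<in> carrier P"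
    and add_left: "\<And>m m' n. \<lbrakk>m \<in> carrier M; m' \<in> carrier M; n \<in> carrier N\<rbrakk>
      \<Longrightarrow> \<beta> (m \<oplus>\<^bsub>M\<^esub> m') n = \<beta> m n \<oplus>\<^bsub>P\<^esub> \<beta> m' n"
    and add_right: "\<And>m n n'. \<lbrakk>m \<in> carrier M; n \<in> carrier N; n' \<in> carrier N\<rbrakk>
      \<Longrightarrow> \<beta> m (n \<oplus>\<^bsub>N\<^esub> n') = \<beta> m n \<oplus>\<^bsub>P\<^esub> \<beta> m n'"
    and smult_left: "\<And>r m n. \<lbrakk>r \<in> carrier R; m \<in> carrier M; n \<in> carrier N\<rbrakk>
      \<Longrightarrow> \<beta> (r \<odot>\<^bsub>M\<^esub> m) n = r \<odot>\<^bsub>P\<^esub> \<beta> m n"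
    and smult_right: "\<And>r m n. \<lbrakk>r \<in> carrier R; m \<in> carrier M; n \<in> carrier N\<rbrakk>
      \<Longrightarrow> \<beta> m (r \<odot>\<^bsub>N\<^esub> n) = r \<odot>\<^bsub>P\<^esub> \<beta> m n"
  obtains h where "h \<in> mod_hom R (tensor_module R M N) P"
    and "\<And>m n. \<lbrakk>m \<in> carrier M; n \<in> carrier N\<rbrakk> \<Longrightarrow> h (pure_tensor R M N m n) = \<beta> m n"
proof -
  interpret M: module R M by fact
  interpret N: module R N by fact
  interpret P: module R P by fact
  let ?F = "free_module R (carrier M \<times> carrier N)" and ?T = "tensor_module R M N"
  let ?q = "restrict (\<lambda>u. tensor_relations R M N +>\<^bsub>?F\<^esub> u) (carrier ?F)"
  interpret F: module R ?F by (rule free_module_module[OF M.R.is_cring])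
  have e: "free_gen R (m, n) \<in> carrier ?F" if "m \<in> carrier M" "n \<in> carrier N" for m n
    by (rule free_gen_closed[OF M.R.is_cring]) (use that in auto)
  obtain g where g: "g \<in> mod_hom R ?F P"
    and g_gen: "\<And>p. p \<in> carrier M \<times> carrier N \<Longrightarrow> g (free_gen R p) = case_prod \<beta> p"
    by (rule free_module_lift[OF M.R.is_cring P.module_axioms,
          where S = "carrier M \<times> carrier N" and \<beta> = "case_prod \<beta>"])
      (use closed in auto)
  have g_gen: "g (free_gen R (m, n)) = \<beta> m n" if "m \<in> carrier M" "n \<in> carrier N" for m n
    using g_gen[of "(m, n)"] that by simp
  have "tensor_relations R M N \<subseteq> {u \<in> carrier ?F. g u = \<zero>\<^bsub>P\<^esub>}"
    unfolding tensor_relations_def Let_def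
    by (rule submodule_generated_least[OF kernel_submodule[OF F.module_axioms P.module_axioms g]])
      (auto simp: e mod_hom_diff[OF F.module_axioms P.module_axioms g] mod_hom_add[OF g]
        mod_hom_smult[OF g] g_gen closed add_left add_right smult_left smult_right
        module_diff_eq_zero_iff[OF P.module_axioms])
  then have ker: "g u = \<zero>\<^bsub>P\<^esub>" if "u \<in> carrier ?F" "?q u = \<zero>\<^bsub>?T\<^esub>" for u
    using that tensor_coset_zero_iff[OF assms(1,2), of u] by auto
  have "?q ` carrier ?F = carrier ?T"
    by (simp add: carrier_tensor_module[OF assms(1,2)])
  then obtain h where h: "h \<in> mod_hom R ?T P" and hq: "\<And>u. u \<in> carrier ?F \<Longrightarrow> h (?q u) = g u"
    using mod_hom_factor_surj[OF F.module_axioms tensor_module_module[OF assms(1,2)]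
        P.module_axioms tensor_coset_hom[OF assms(1,2)] _ g ker] by metis
  show thesis
  proof
    show "h \<in> mod_hom R ?T P" by fact
    show "h (pure_tensor R M N m n) = \<beta> m n" if "m \<in> carrier M" "n \<in> carrier N" for m n
      using hq[OF e[OF that]] e[OF that] g_gen[OF that] by (simp add: pure_tensor_def)
  qed
qed

text \<open>
  The definite description defining \<^const>\<open>tensor_map\<close> denotes: existence is the universal property, and
  uniqueness holds because pure tensors generate.
\<close>

lemma tensor_map_pure:
  assumes "module R M" "module R N" "module R M'" "module R N'"
    and f: "f \<in> mod_hom R M M'" and g: "g \<in> mod_hom R N N'"
    and "m \<in> carrier M" "n \<in> carrier N"
  shows "tensor_map R M N M' N' f g (pure_tensor R M N m n) = pure_tensor R M' N' (f m) (g n)"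
proof -
  let ?P = "\<lambda>h. h \<in> mod_hom R (tensor_module R M N) (tensor_module R M' N') \<and>
      (\<forall>m\<in>carrier M. \<forall>n\<in>carrier N.
        h (pure_tensor R M N m n) = pure_tensor R M' N' (f m) (g n))"
  note T' = tensor_module_module[OF assms(3,4)]
  have "\<exists>h. ?P h"
    by (rule tensor_lift[OF assms(1,2) T', where \<beta> = "\<lambda>m n. pure_tensor R M' N' (f m) (g n)"])
      (auto simp: mod_hom_closed[OF f] mod_hom_closed[OF g] mod_hom_add[OF f] mod_hom_add[OF g]
        mod_hom_smult[OF f] mod_hom_smult[OF g] pure_tensor[OF assms(3,4)])
  moreover have "h = h'" if "?P h" "?P h'" for h h'
    by (rule tensor_hom_eqI[OF assms(1,2) T']) (use that in auto)
  ultimately have "\<exists>!h. ?P h" by (rule ex_ex1I)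
  then have "?P (THE h. ?P h)" by (rule theI')
  then show ?thesis using assms(7,8) by (simp add: tensor_map_def)
qed

text \<open>
  On pure tensors \<open>r (m \<otimes> n) = (r m) \<otimes> n = 0 \<otimes> n = 0\<close>, and the elements annihilated by \<open>r\<close> form a submodule
  since \<open>R\<close> is commutative.
\<close>

lemma tensor_module_annihilated:
  assumes "module R M" "module R N" and r: "r \<in> carrier R"
    and "\<And>m. m \<in> carrier M \<Longrightarrow> r \<odot>\<^bsub>M\<^esub> m = \<zero>\<^bsub>M\<^esub>"
    and z: "z \<in> carrier (tensor_module R M N)"
  shows "r \<odot>\<^bsub>tensor_module R M N\<^esub> z = \<zero>\<^bsub>tensor_module R M N\<^esub>"
proof -
  interpret M: module R M by fact
  let ?T = "tensor_module R M N"
  interpret T: module R ?T by (rule tensor_module_module[OF assms(1,2)])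
  have "submodule {z \<in> carrier ?T. r \<odot>\<^bsub>?T\<^esub> z = \<zero>\<^bsub>?T\<^esub>} R ?T"
  proof (rule T.submoduleI)
    fix a x assume "a \<in> carrier R" "x \<in> {z \<in> carrier ?T. r \<odot>\<^bsub>?T\<^esub> z = \<zero>\<^bsub>?T\<^esub>}"
    then show "a \<odot>\<^bsub>?T\<^esub> x \<in> {z \<in> carrier ?T. r \<odot>\<^bsub>?T\<^esub> z = \<zero>\<^bsub>?T\<^esub>}"
      using r T.smult_assoc1[of r a x] T.smult_assoc1[of a r x] by (simp add: M.R.m_comm)
  qed (use r in \<open>auto simp: T.smult_r_distr T.smult_r_minus\<close>)
  then have "z \<in> {z \<in> carrier ?T. r \<odot>\<^bsub>?T\<^esub> z = \<zero>\<^bsub>?T\<^esub>}"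
  proof (rule tensor_module_generated[OF assms(1,2) _ _ z])
    fix m n assume mn: "m \<in> carrier M" "n \<in> carrier N"
    have "pure_tensor R M N \<zero>\<^bsub>M\<^esub> n = \<zero>\<^bsub>R\<^esub> \<odot>\<^bsub>?T\<^esub> pure_tensor R M N \<zero>\<^bsub>M\<^esub> n"
      using pure_tensor_smult_left[OF assms(1,2) M.R.zero_closed M.M.zero_closed mn(2)] by simp
    also have "\<dots> = \<zero>\<^bsub>?T\<^esub>"
      using pure_tensor_closed[OF assms(1,2) M.M.zero_closed mn(2)] by simp
    finally show "pure_tensor R M N m n \<in> {z \<in> carrier ?T. r \<odot>\<^bsub>?T\<^esub> z = \<zero>\<^bsub>?T\<^esub>}"
      using pure_tensor_smult_left[OF assms(1,2) r mn] assms(4)[OF mn(1)]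
        pure_tensor_closed[OF assms(1,2) mn] by simp
  qed
  then show ?thesis by simp
qed


section \<open>Adic completion with respect to an idempotent ideal\<close>

lemma ring_as_module_module:
  assumes "cring R"
  shows "module R (ring_as_module R)"
proof -
  interpret cring R by fact
  show ?thesis
  proof (rule moduleI)
    show "abelian_group (ring_as_module R)"
      by (rule abelian_groupI)
        (auto simp: ring_as_module_def a_ac intro: l_neg bexI[of _ "\<ominus>\<^bsub>R\<^esub> x" for x])
  qed (auto simp: ring_as_module_def l_distr r_distr m_assoc is_cring)
qed

lemma ideal_submodule:
  assumes "cring R" "ideal J R"
  shows "submodule J R (ring_as_module R)"
proof -
  interpret cring R by fact
  interpret J: ideal J R by fact
  interpret R': module R "ring_as_module R" by (rule ring_as_module_module) fact
  have minus: "\<ominus>\<^bsub>ring_as_module R\<^esub> x = \<ominus>\<^bsub>R\<^esub> x" if "x \<in> carrier R" for x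
    using R'.smult_l_minus[OF one_closed, of x] that
    by (simp add: ring_as_module_def l_minus)
  show ?thesis
    by (rule R'.submoduleI)
      (auto simp: minus J.Icarr, auto simp: ring_as_module_def J.I_l_closed J.Icarr)
qed

lemma ideal_power:
  assumes "cring R" "ideal I R"
  shows ideal_power_ideal: "ideal (ideal_power R I k) R"
    and ideal_power_Suc_subset: "ideal_power R I (Suc k) \<subseteq> ideal_power R I k"
    and ideal_power_Suc_idempotent: "I = I \<cdot>\<^bsub>R\<^esub> I \<Longrightarrow> ideal_power R I (Suc k) = I"
proof -
  interpret cring R by fact
  interpret S: semiring "ideals_set R" by (rule ideals_set_is_semiring)
  have I: "I \<in> carrier (ideals_set R)" using assms by (simp add: ideals_set_def)
  have ideal: "ideal (ideal_power R I k) R" for k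
    using S.nat_pow_closed[OF I, of k] by (simp add: ideals_set_def)
  have power_Suc: "ideal_power R I (Suc k) = ideal_power R I k \<cdot>\<^bsub>R\<^esub> I" for k
    using S.nat_pow_Suc[of I k] by (simp add: ideals_set_def)
  show "ideal (ideal_power R I k) R" by fact
  show "ideal_power R I (Suc k) \<subseteq> ideal_power R I k"
    unfolding power_Suc using ideal_prod_inter[OF ideal assms(2)] by blast
  show "ideal_power R I (Suc k) = I" if "I = I \<cdot>\<^bsub>R\<^esub> I"
  proof (induction k)
    case 0
    show ?case using S.l_one[OF I] power_Suc[of 0] by (simp add: ideals_set_def)
  next
    case (Suc k)
    then show ?case using power_Suc[of "Suc k"] that by simp
  qed
qed

text \<open>
  This computes \<^const>\<open>adic_proj\<close> on cosets: it sends the class of \<open>x\<close> modulo the smaller ideal to the class of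
  \<open>x\<close> modulo the larger one.
\<close>

lemma coset_absorb:
  assumes "cring R" "ideal J R" "ideal K R" "J \<subseteq> K" "x \<in> carrier R"
  shows "K <+>\<^bsub>R\<^esub> (J +>\<^bsub>ring_as_module R\<^esub> x) = K +>\<^bsub>ring_as_module R\<^esub> x"
proof -
  interpret cring R by fact
  interpret J: ideal J R by fact
  interpret K: ideal K R by fact
  have assoc: "k \<oplus>\<^bsub>R\<^esub> (j \<oplus>\<^bsub>R\<^esub> x) = (k \<oplus>\<^bsub>R\<^esub> j) \<oplus>\<^bsub>R\<^esub> x" if "k \<in> K" "j \<in> J" for k j
    using that assms(5) by (simp add: a_assoc J.Icarr K.Icarr)
  have "\<exists>k\<in>K. \<exists>j\<in>J. z = k \<oplus>\<^bsub>R\<^esub> (j \<oplus>\<^bsub>R\<^esub> x)" if "k \<in> K" "z = k \<oplus>\<^bsub>R\<^esub> x" for k z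
    using that assms(5) J.zero_closed by (intro bexI[of _ k] bexI[of _ "\<zero>\<^bsub>R\<^esub>"]) auto
  moreover have "\<exists>h\<in>K. z = h \<oplus>\<^bsub>R\<^esub> x" if "k \<in> K" "j \<in> J" "z = k \<oplus>\<^bsub>R\<^esub> (j \<oplus>\<^bsub>R\<^esub> x)" for k j z
    using that assoc[OF that(1,2)] assms(4) by (intro bexI[of _ "k \<oplus>\<^bsub>R\<^esub> j"]) auto
  ultimately show ?thesis
    unfolding set_add_def' a_r_coset_def' by (auto simp: ring_as_module_def)
qed

lemma adic_quot_module: "\<lbrakk>cring R; ideal I R\<rbrakk> \<Longrightarrow> module R (adic_quot R I k)"
  unfolding adic_quot_def
  by (rule quot_module_module[OF ring_as_module_module ideal_submodule[OF _ ideal_power_ideal]])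

text \<open>
  The class of \<open>1\<close>, which generates \<open>R/I\<^sup>k\<close>.
\<close>

definition adic_one :: "('r, 'x) ring_scheme \<Rightarrow> 'r set \<Rightarrow> nat \<Rightarrow> 'r set"
  where "adic_one R I k = ideal_power R I k +>\<^bsub>ring_as_module R\<^esub> \<one>\<^bsub>R\<^esub>"

lemma adic_quot:
  assumes "cring R" "ideal I R"
  shows carrier_adic_quot: "carrier (adic_quot R I k) =
      (\<lambda>r. ideal_power R I k +>\<^bsub>ring_as_module R\<^esub> r) ` carrier R"
    and adic_coset_add: "\<And>r s. \<lbrakk>r \<in> carrier R; s \<in> carrier R\<rbrakk> \<Longrightarrow>
      (ideal_power R I k +>\<^bsub>ring_as_module R\<^esub> r) \<oplus>\<^bsub>adic_quot R I k\<^esub>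
        (ideal_power R I k +>\<^bsub>ring_as_module R\<^esub> s)
      = ideal_power R I k +>\<^bsub>ring_as_module R\<^esub> (r \<oplus>\<^bsub>R\<^esub> s)"
    and adic_coset_smult: "\<And>r s. \<lbrakk>r \<in> carrier R; s \<in> carrier R\<rbrakk> \<Longrightarrow>
      r \<odot>\<^bsub>adic_quot R I k\<^esub> (ideal_power R I k +>\<^bsub>ring_as_module R\<^esub> s)
      = ideal_power R I k +>\<^bsub>ring_as_module R\<^esub> (r \<otimes>\<^bsub>R\<^esub> s)"
    and adic_coset_zero: "\<And>r. r \<in> ideal_power R I k \<Longrightarrow>
      ideal_power R I k +>\<^bsub>ring_as_module R\<^esub> r = \<zero>\<^bsub>adic_quot R I k\<^esub>"
proof -
  interpret cring R by fact
  let ?J = "ideal_power R I k" and ?R = "ring_as_module R"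
  interpret J: ideal ?J R by (rule ideal_power_ideal[OF assms])
  note RJ = ring_as_module_module[OF assms(1)] ideal_submodule[OF assms(1) J.ideal_axioms]
  have R': "carrier ?R = carrier R" "a \<oplus>\<^bsub>?R\<^esub> b = a \<oplus>\<^bsub>R\<^esub> b" "a \<odot>\<^bsub>?R\<^esub> b = a \<otimes>\<^bsub>R\<^esub> b" for a b
    by (simp_all add: ring_as_module_def)
  show "carrier (adic_quot R I k) = (\<lambda>r. ?J +>\<^bsub>?R\<^esub> r) ` carrier R"
    using carrier_quot_module[OF RJ] by (simp add: adic_quot_def R')
  show "(?J +>\<^bsub>?R\<^esub> r) \<oplus>\<^bsub>adic_quot R I k\<^esub> (?J +>\<^bsub>?R\<^esub> s) = ?J +>\<^bsub>?R\<^esub> (r \<oplus>\<^bsub>R\<^esub> s)"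
    if "r \<in> carrier R" "s \<in> carrier R" for r s
    using mod_hom_add[OF coset_mod_hom[OF RJ], of r s] that by (simp add: adic_quot_def R')
  show "r \<odot>\<^bsub>adic_quot R I k\<^esub> (?J +>\<^bsub>?R\<^esub> s) = ?J +>\<^bsub>?R\<^esub> (r \<otimes>\<^bsub>R\<^esub> s)"
    if "r \<in> carrier R" "s \<in> carrier R" for r s
    using quot_smult_coset[OF RJ, of r s] that by (simp add: adic_quot_def R')
  show "?J +>\<^bsub>?R\<^esub> r = \<zero>\<^bsub>adic_quot R I k\<^esub>" if "r \<in> ?J" for r
    using coset_zero_iff[OF RJ, of r] that J.Icarr by (simp add: adic_quot_def R')
qed

lemma adic_one_closed: "\<lbrakk>cring R; ideal I R\<rbrakk> \<Longrightarrow> adic_one R I k \<in> carrier (adic_quot R I k)"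
  by (simp add: adic_one_def carrier_adic_quot cring.cring_simprules)

lemma adic_quot_cyclic:
  assumes "cring R" "ideal I R" "X \<in> carrier (adic_quot R I k)"
  obtains r where "r \<in> carrier R" "X = r \<odot>\<^bsub>adic_quot R I k\<^esub> adic_one R I k"
proof -
  interpret cring R by fact
  from assms show thesis
    by (auto simp: carrier_adic_quot adic_one_def adic_coset_smult intro: that)
qed

lemma adic_quot_annihilated:
  assumes "cring R" "ideal I R" "r \<in> ideal_power R I k" "X \<in> carrier (adic_quot R I k)"
  shows "r \<odot>\<^bsub>adic_quot R I k\<^esub> X = \<zero>\<^bsub>adic_quot R I k\<^esub>"
proof -
  interpret J: ideal "ideal_power R I k" R by (rule ideal_power_ideal[OF assms(1,2)])
  obtain s where "s \<in> carrier R" "X = ideal_power R I k +>\<^bsub>ring_as_module R\<^esub> s"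
    using assms(4) by (auto simp: carrier_adic_quot[OF assms(1,2)])
  then show ?thesis
    using adic_coset_zero[OF assms(1,2) J.I_r_closed[OF assms(3)]]
    by (simp add: adic_coset_smult[OF assms(1,2)] J.Icarr[OF assms(3)])
qed

lemma adic_proj:
  assumes "cring R" "ideal I R"
  shows adic_proj_hom: "adic_proj R I k \<in> mod_hom R (adic_quot R I (Suc k)) (adic_quot R I k)"
    and adic_proj_one: "adic_proj R I k (adic_one R I (Suc k)) = adic_one R I k"
proof -
  interpret cring R by fact
  have p: "adic_proj R I k (ideal_power R I (Suc k) +>\<^bsub>ring_as_module R\<^esub> r)
      = ideal_power R I k +>\<^bsub>ring_as_module R\<^esub> r" if "r \<in> carrier R" for r
    using that coset_absorb[OF assms(1) ideal_power_ideal[OF assms] ideal_power_ideal[OF assms]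
        ideal_power_Suc_subset[OF assms] that]
    by (simp add: adic_proj_def carrier_adic_quot[OF assms])
  show "adic_proj R I k \<in> mod_hom R (adic_quot R I (Suc k)) (adic_quot R I k)"
  proof (rule mod_homI)
    show "adic_proj R I k \<in> extensional (carrier (adic_quot R I (Suc k)))"
      by (simp add: adic_proj_def)
    fix X assume "X \<in> carrier (adic_quot R I (Suc k))"
    then obtain r where r: "r \<in> carrier R"
        "X = ideal_power R I (Suc k) +>\<^bsub>ring_as_module R\<^esub> r"
      unfolding carrier_adic_quot[OF assms] by blast
    show "adic_proj R I k X \<in> carrier (adic_quot R I k)"
      unfolding r(2) p[OF r(1)] carrier_adic_quot[OF assms] using r(1) by (rule imageI)
    show "adic_proj R I k (a \<odot>\<^bsub>adic_quot R I (Suc k)\<^esub> X) = a \<odot>\<^bsub>adic_quot R I k\<^esub> adic_proj R I k X"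
      if "a \<in> carrier R" for a
      using that r(1) by (simp only: r(2) p adic_coset_smult[OF assms] m_closed)
    fix Y assume "Y \<in> carrier (adic_quot R I (Suc k))"
    then obtain s where s: "s \<in> carrier R"
        "Y = ideal_power R I (Suc k) +>\<^bsub>ring_as_module R\<^esub> s"
      unfolding carrier_adic_quot[OF assms] by blast
    show "adic_proj R I k (X \<oplus>\<^bsub>adic_quot R I (Suc k)\<^esub> Y)
        = adic_proj R I k X \<oplus>\<^bsub>adic_quot R I k\<^esub> adic_proj R I k Y"
      using r(1) s(1) by (simp only: r(2) s(2) p adic_coset_add[OF assms] a_closed)
  qed
  show "adic_proj R I k (adic_one R I (Suc k)) = adic_one R I k"
    unfolding adic_one_def by (rule p[OF one_closed])
qed

text \<open>
  The \<open>k\<close>-th component \<open>m \<mapsto> 1 \<otimes> m\<close> of the canonical map from \<open>M\<close> to its completion.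
\<close>

definition adic_level ::
  "('r, 'x) ring_scheme \<Rightarrow> 'r set \<Rightarrow> ('r, 'm, 'y) module_scheme \<Rightarrow> nat \<Rightarrow> 'm \<Rightarrow> ('r set \<times> 'm \<Rightarrow> 'r) set"
  where "adic_level R I M k =
    restrict (\<lambda>m. pure_tensor R (adic_quot R I k) M (adic_one R I k) m) (carrier M)"

lemma adic_level_hom:
  assumes "module R M" "ideal I R"
  shows "adic_level R I M k \<in> mod_hom R M (tensor_module R (adic_quot R I k) M)"
proof -
  interpret M: module R M by fact
  note pt = pure_tensor[OF adic_quot_module[OF M.R.is_cring assms(2)] assms(1)]
  show ?thesis
    by (rule mod_homI) (simp_all add: adic_level_def pt adic_one_closed[OF M.R.is_cring assms(2)])
qed

text \<open>
  Each element of \<open>R/I\<^sup>k\<close> is a multiple of \<open>1\<close>, and scalars move across the tensor sign: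
  \<open>r 1 \<otimes> m = 1 \<otimes> r m\<close>.
\<close>

lemma adic_level_surj:
  assumes "module R M" "ideal I R"
  shows "adic_level R I M k ` carrier M = carrier (tensor_module R (adic_quot R I k) M)"
proof -
  interpret M: module R M by fact
  let ?Q = "adic_quot R I k"
  note Q = adic_quot_module[OF M.R.is_cring assms(2), of k]
  note one = adic_one_closed[OF M.R.is_cring assms(2)]
  note h = adic_level_hom[OF assms]
  have "z \<in> adic_level R I M k ` carrier M" if "z \<in> carrier (tensor_module R ?Q M)" for z
  proof (rule tensor_module_generated[OF Q assms(1)
        image_submodule[OF assms(1) tensor_module_module[OF Q assms(1)] h] _ that])
    fix X m assume "X \<in> carrier ?Q" and m: "m \<in> carrier M"
    then obtain r where r: "r \<in> carrier R" "X = r \<odot>\<^bsub>?Q\<^esub> adic_one R I k"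
      using adic_quot_cyclic[OF M.R.is_cring assms(2)] by metis
    have "pure_tensor R ?Q M X m = pure_tensor R ?Q M (adic_one R I k) (r \<odot>\<^bsub>M\<^esub> m)"
      using pure_tensor_smult_left[OF Q assms(1) r(1) one m]
        pure_tensor_smult_right[OF Q assms(1) r(1) one m] r by simp
    also have "\<dots> = adic_level R I M k (r \<odot>\<^bsub>M\<^esub> m)" using r m by (simp add: adic_level_def)
    finally show "pure_tensor R ?Q M X m \<in> adic_level R I M k ` carrier M" using r m by simp
  qed
  then show ?thesis using mod_hom_closed[OF h] by blast
qed

text \<open>
  If \<open>I\<^sup>k\<close> annihilates \<open>M\<close>, then \<open>r m\<close> depends only on the class of \<open>r\<close> modulo \<open>I\<^sup>k\<close>. The induced
  map \<open>R/I\<^sup>k \<otimes> M \<rightarrow> M\<close> is a left inverse.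
\<close>

lemma adic_level_inj:
  assumes "module R M" "ideal I R"
    and ann: "\<And>r m. \<lbrakk>r \<in> ideal_power R I k; m \<in> carrier M\<rbrakk> \<Longrightarrow> r \<odot>\<^bsub>M\<^esub> m = \<zero>\<^bsub>M\<^esub>"
  shows "inj_on (adic_level R I M k) (carrier M)"
proof -
  interpret M: module R M by fact
  interpret J: ideal "ideal_power R I k" R by (rule ideal_power_ideal[OF M.R.is_cring assms(2)])
  let ?Q = "adic_quot R I k" and ?c = "\<lambda>r. ideal_power R I k +>\<^bsub>ring_as_module R\<^esub> r"
  note Q = adic_quot_module[OF M.R.is_cring assms(2), of k]
  note carr = carrier_adic_quot[OF M.R.is_cring assms(2), of k]
  let ?\<beta> = "\<lambda>X m. (SOME r. r \<in> X) \<odot>\<^bsub>M\<^esub> m"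
  \<comment> \<open>any representative of the class may be used in place of the chosen one\<close>
  have \<beta>: "?\<beta> (?c r) m = r \<odot>\<^bsub>M\<^esub> m" if r: "r \<in> carrier R" and m: "m \<in> carrier M" for r m
  proof -
    have in_c: "s \<in> ?c r \<longleftrightarrow> (\<exists>j\<in>ideal_power R I k. s = j \<oplus>\<^bsub>R\<^esub> r)" for s
      by (auto simp: a_r_coset_def' ring_as_module_def)
    have "\<zero>\<^bsub>R\<^esub> \<oplus>\<^bsub>R\<^esub> r \<in> ?c r" using J.zero_closed in_c by blast
    then have "(SOME r'. r' \<in> ?c r) \<in> ?c r" by (rule someI)
    then obtain j where j: "j \<in> ideal_power R I k" "(SOME r'. r' \<in> ?c r) = j \<oplus>\<^bsub>R\<^esub> r"
      using in_c by blast
    then show ?thesis using r m J.Icarr by (simp add: M.smult_l_distr ann)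
  qed
  obtain h where "h \<in> mod_hom R (tensor_module R ?Q M) M"
    and h: "\<And>X m. \<lbrakk>X \<in> carrier ?Q; m \<in> carrier M\<rbrakk> \<Longrightarrow> h (pure_tensor R ?Q M X m) = ?\<beta> X m"
    by (rule tensor_lift[OF Q assms(1,1), where \<beta> = ?\<beta>])
      (auto simp: carr adic_coset_add[OF M.R.is_cring assms(2)]
        adic_coset_smult[OF M.R.is_cring assms(2)] \<beta> M.smult_l_distr M.smult_r_distr
        M.smult_assoc1[symmetric] M.R.m_comm)
  have "h (adic_level R I M k m) = m" if "m \<in> carrier M" for m
    using that h[OF adic_one_closed[OF M.R.is_cring assms(2)] that] \<beta>[OF M.R.one_closed that]
    by (simp add: adic_level_def adic_one_def)
  then show ?thesis by (rule inj_on_inverseI)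
qed

lemma adic_level_step:
  assumes "module R M" "ideal I R" "m \<in> carrier M"
  shows "tensor_map R (adic_quot R I (Suc k)) M (adic_quot R I k) M
    (adic_proj R I k) (restrict id (carrier M)) (adic_level R I M (Suc k) m) = adic_level R I M k m"
proof -
  interpret M: module R M by fact
  note Q = adic_quot_module[OF M.R.is_cring assms(2)]
  show ?thesis
    using tensor_map_pure[OF Q assms(1) Q assms(1) adic_proj_hom[OF M.R.is_cring assms(2)]
        mod_hom_id[OF assms(1)] adic_one_closed[OF M.R.is_cring assms(2)] assms(3), of k]
      adic_proj_one[OF M.R.is_cring assms(2)] assms(3)
    by (simp add: adic_level_def)
qed

text \<open>
  Each \<open>R/I\<^sup>k\<close> is annihilated by \<open>I\<close>, as \<open>I\<close> is contained in all of its powers. Hence so is the completion,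
  and an injective homomorphism from \<open>M\<close> into it shows \<open>IM = 0\<close>. Conversely, if \<open>IM = 0\<close> then
  \<^const>\<open>adic_level\<close> is bijective at every positive level and compatible with the transition maps, so a compatible
  family is determined by its entry at level \<open>1\<close>, and the canonical map is an isomorphism.
\<close>

theorem adically_complete_iff_annihilated:
  assumes "module R M" "ideal I R" and idem: "I = I \<cdot>\<^bsub>R\<^esub> I"
  shows "adically_complete R I M \<longleftrightarrow> (\<forall>r\<in>I. \<forall>m\<in>carrier M. r \<odot>\<^bsub>M\<^esub> m = \<zero>\<^bsub>M\<^esub>)"
proof
  interpret M: module R M by fact
  interpret I: ideal I R by fact
  let ?L = "adic_completion R I M" and ?T = "\<lambda>k. tensor_module R (adic_quot R I k) M"
  note power_Suc = ideal_power_Suc_idempotent[OF M.R.is_cring assms(2) idem]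
  assume "adically_complete R I M"
  then obtain f where f: "f \<in> mod_hom R M ?L" and inj: "inj_on f (carrier M)"
    by (auto simp: adically_complete_def mod_isomorphic_def bij_betw_def)
  have subset: "I \<subseteq> ideal_power R I k" for k
    using power_Suc ideal_power_Suc_subset[OF M.R.is_cring assms(2)] by blast
  have kills: "r \<odot>\<^bsub>?L\<^esub> f m = (\<lambda>k. \<zero>\<^bsub>?T k\<^esub>)" if r: "r \<in> I" and m: "m \<in> carrier M" for r m
  proof -
    have "f m k \<in> carrier (?T k)" for k
      using mod_hom_closed[OF f m] by (simp add: adic_completion_def inverse_limit_module_def)
    then have "r \<odot>\<^bsub>?T k\<^esub> f m k = \<zero>\<^bsub>?T k\<^esub>" for k
      using r subset
      by (intro tensor_module_annihilated[OF adic_quot_module[OF M.R.is_cring assms(2)] assms(1)]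
          adic_quot_annihilated[OF M.R.is_cring assms(2)] I.Icarr) auto
    then show ?thesis by (simp add: adic_completion_def inverse_limit_module_def)
  qed
  show "\<forall>r\<in>I. \<forall>m\<in>carrier M. r \<odot>\<^bsub>M\<^esub> m = \<zero>\<^bsub>M\<^esub>"
  proof (intro ballI)
    fix r m assume r: "r \<in> I" and m: "m \<in> carrier M"
    \<comment> \<open>comparison with the image of zero, where \<open>r\<close> acts in the
        same way\<close>
    have "f (r \<odot>\<^bsub>M\<^esub> m) = f (r \<odot>\<^bsub>M\<^esub> \<zero>\<^bsub>M\<^esub>)"
      using kills[OF r m] kills[OF r M.M.zero_closed] I.Icarr[OF r] m
      by (simp only: mod_hom_smult[OF f] M.M.zero_closed)
    then show "r \<odot>\<^bsub>M\<^esub> m = \<zero>\<^bsub>M\<^esub>"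
      using inj I.Icarr[OF r] m by (simp add: inj_on_eq_iff)
  qed
next
  interpret M: module R M by fact
  let ?L = "adic_completion R I M" and ?T = "\<lambda>k. tensor_module R (adic_quot R I k) M"
  let ?t = "\<lambda>k. tensor_map R (adic_quot R I (Suc k)) M (adic_quot R I k) M
    (adic_proj R I k) (restrict id (carrier M))"
  let ?l = "adic_level R I M"
  note power_Suc = ideal_power_Suc_idempotent[OF M.R.is_cring assms(2) idem]
  note hom = adic_level_hom[OF assms(1,2)]
  note step = adic_level_step[OF assms(1,2)]
  assume ann: "\<forall>r\<in>I. \<forall>m\<in>carrier M. r \<odot>\<^bsub>M\<^esub> m = \<zero>\<^bsub>M\<^esub>"
  have inj: "inj_on (?l (Suc k)) (carrier M)" for k
    by (rule adic_level_inj[OF assms(1,2)]) (use ann in \<open>simp only: power_Suc\<close>)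
  define c where "c = restrict (\<lambda>m k. ?l k m) (carrier M)"
  have c: "c \<in> mod_hom R M ?L"
    by (rule mod_homI)
      (simp_all add: c_def adic_completion_def inverse_limit_module_def mod_hom_closed[OF hom]
        mod_hom_add[OF hom] mod_hom_smult[OF hom] step)
  have "inj_on c (carrier M)"
    by (rule inj_onI) (metis c_def inj inj_onD restrict_apply')
  moreover have "x \<in> c ` carrier M" if "x \<in> carrier ?L" for x
  proof -
    have x: "x k \<in> carrier (?T k)" "?t k (x (Suc k)) = x k" for k
      using that by (simp_all add: adic_completion_def inverse_limit_module_def)
    have "\<exists>m\<in>carrier M. x k = ?l k m" for k
      using x(1)[of k] unfolding adic_level_surj[OF assms(1,2), symmetric] by auto
    then obtain m where m: "m k \<in> carrier M" "x k = ?l k (m k)" for k by metis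
    \<comment> \<open>for \<open>k > 0\<close> this gives equal lifts by injectivity; at level \<open>0\<close>
        it is all that is available, and it suffices\<close>
    have next_eq: "?l k (m (Suc k)) = ?l k (m k)" for k
      using x(2)[of k] step[OF m(1)[of "Suc k"], of k] m(2) by simp
    then have "m (Suc (Suc k)) = m (Suc k)" for k
      using inj[of k] m(1) by (meson inj_onD)
    then have "m (Suc k) = m (Suc 0)" for k by (induction k) simp_all
    then have "x k = ?l k (m (Suc 0))" for k
      using m(2) next_eq by (cases k) metis+
    then have "x = c (m (Suc 0))" using m(1) by (auto simp: c_def)
    then show ?thesis using m(1) by blast
  qed
  ultimately have "bij_betw c (carrier M) (carrier ?L)"
    using mod_hom_closed[OF c] by (auto simp: bij_betw_def)
  with c show "adically_complete R I M"
    by (auto simp: adically_complete_def mod_isomorphic_def)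
qed


section \<open>Quotients and direct sums with carriers in the same type\<close>

text \<open>
  The carrier of the quotient is a system of representatives, one chosen in each coset, so that it lies in the
  same type as the carrier of \<open>M\<close>.
\<close>

lemma quotient_on_same_type:
  fixes M :: "('r, 'm) module"
  assumes "module R M" "submodule H R M"
  obtains Q :: "('r, 'm) module" and c where "module R Q" "c \<in> mod_hom R M Q"
    "c ` carrier M = carrier Q" "\<And>x. x \<in> carrier M \<Longrightarrow> c x = \<zero>\<^bsub>Q\<^esub> \<longleftrightarrow> x \<in> H"
proof -
  interpret M: module R M by fact
  interpret H: abelian_subgroup H M by (rule submodule_abelian_subgroup[OF assms])
  define c where "c = restrict (\<lambda>x. SOME y. y \<in> H +>\<^bsub>M\<^esub> x) (carrier M)"
  define Q :: "('r, 'm) module" where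
    "Q = \<lparr>carrier = c ` carrier M, mult = undefined, one = undefined, zero = c \<zero>\<^bsub>M\<^esub>,
      add = (\<lambda>a b. c (a \<oplus>\<^bsub>M\<^esub> b)), smult = (\<lambda>r a. c (r \<odot>\<^bsub>M\<^esub> a))\<rparr>"
  have c_mem: "c x \<in> H +>\<^bsub>M\<^esub> x" if "x \<in> carrier M" for x
    using someI[of "\<lambda>y. y \<in> H +>\<^bsub>M\<^esub> x", OF H.a_rcos_self[OF that]] that by (simp add: c_def)
  have c_carrier: "c x \<in> carrier M" if "x \<in> carrier M" for x
    using c_mem[OF that] M.M.a_r_coset_subset_G[OF H.a_subset that] by auto
  have c_coset: "H +>\<^bsub>M\<^esub> c x = H +>\<^bsub>M\<^esub> x" if "x \<in> carrier M" for x
    using M.M.a_repr_independence[OF c_mem[OF that] that H.a_subgroup] by simp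
  have c_eq: "c x = c y \<longleftrightarrow> H +>\<^bsub>M\<^esub> x = H +>\<^bsub>M\<^esub> y" if "x \<in> carrier M" "y \<in> carrier M" for x y
    using c_coset[OF that(1)] c_coset[OF that(2)] that by (metis c_def restrict_apply')
  have c_add: "c (c x \<oplus>\<^bsub>M\<^esub> c y) = c (x \<oplus>\<^bsub>M\<^esub> y)" if "x \<in> carrier M" "y \<in> carrier M" for x y
    using H.a_rcos_sum[OF c_carrier[OF that(1)] c_carrier[OF that(2)]] H.a_rcos_sum[OF that]
      c_coset[OF that(1)] c_coset[OF that(2)] c_carrier that
    by (subst c_eq) simp_all
  have c_smult: "c (r \<odot>\<^bsub>M\<^esub> c x) = c (r \<odot>\<^bsub>M\<^esub> x)" if "r \<in> carrier R" "x \<in> carrier M" for r x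
    using quot_smult_coset[OF assms that(1) c_carrier[OF that(2)]] quot_smult_coset[OF assms that]
      c_coset[OF that(2)] c_carrier that
    by (subst c_eq) simp_all
  show thesis
  proof
    show "module R Q"
      by (rule module_surj_image[OF assms(1), where p = c]) (simp_all add: Q_def c_add c_smult)
    show "c \<in> mod_hom R M Q"
      by (rule mod_homI) (simp_all add: Q_def c_add c_smult, simp add: c_def)
    show "c ` carrier M = carrier Q" by (simp add: Q_def)
    show "c x = \<zero>\<^bsub>Q\<^esub> \<longleftrightarrow> x \<in> H" if "x \<in> carrier M" for x
      using c_eq[OF that M.M.zero_closed] coset_zero_iff[OF assms that] coset_zero_iff[OF assms M.M.zero_closed]
        submodule_zero[OF assms]
      by (simp add: Q_def)
  qed
qed

text \<open>
  An infinite type has the cardinality of its square. An injection \<open>e\<close> of pairs into the type carries the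
  componentwise operations to it.
\<close>

lemma direct_sum_on_same_type:
  fixes M N :: "('r, 'm) module"
  assumes "infinite (UNIV :: 'm set)" "module R M" "module R N"
  obtains Q :: "('r, 'm) module" and i j p q where "module R Q"
    "i \<in> mod_hom R M Q" "j \<in> mod_hom R N Q" "p \<in> mod_hom R Q M" "q \<in> mod_hom R Q N"
    "\<And>x. x \<in> carrier M \<Longrightarrow> p (i x) = x" "\<And>y. y \<in> carrier N \<Longrightarrow> q (j y) = y"
    "\<And>x. x \<in> carrier M \<Longrightarrow> q (i x) = \<zero>\<^bsub>N\<^esub>" "\<And>y. y \<in> carrier N \<Longrightarrow> p (j y) = \<zero>\<^bsub>M\<^esub>"
    "\<And>z. z \<in> carrier Q \<Longrightarrow> i (p z) \<oplus>\<^bsub>Q\<^esub> j (q z) = z"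
proof -
  interpret M: module R M by fact
  interpret N: module R N by fact
  obtain e :: "'m \<times> 'm \<Rightarrow> 'm" where "inj e"
    using card_of_ordLeq[THEN iffD2, OF ordIso_imp_ordLeq[OF card_of_Times_same_infinite[OF assms(1)]]]
    by auto
  define d where "d = inv_into UNIV e"
  have de [simp]: "d (e z) = z" for z using \<open>inj e\<close> by (simp add: d_def)
  define Q :: "('r, 'm) module" where
    "Q = \<lparr>carrier = e ` (carrier M \<times> carrier N), mult = undefined, one = undefined,
      zero = e (\<zero>\<^bsub>M\<^esub>, \<zero>\<^bsub>N\<^esub>),
      add = (\<lambda>a b. e (fst (d a) \<oplus>\<^bsub>M\<^esub> fst (d b), snd (d a) \<oplus>\<^bsub>N\<^esub> snd (d b))),
      smult = (\<lambda>r a. e (r \<odot>\<^bsub>M\<^esub> fst (d a), r \<odot>\<^bsub>N\<^esub> snd (d a)))\<rparr>"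
  have carrE: thesis if "z \<in> carrier Q" "\<And>x y. \<lbrakk>x \<in> carrier M; y \<in> carrier N; z = e (x, y)\<rbrakk> \<Longrightarrow> thesis"
    for z thesis
    using that by (auto simp: Q_def)
  have ops: "e (x, y) \<oplus>\<^bsub>Q\<^esub> e (x', y') = e (x \<oplus>\<^bsub>M\<^esub> x', y \<oplus>\<^bsub>N\<^esub> y')" "\<zero>\<^bsub>Q\<^esub> = e (\<zero>\<^bsub>M\<^esub>, \<zero>\<^bsub>N\<^esub>)"
    "r \<odot>\<^bsub>Q\<^esub> e (x, y) = e (r \<odot>\<^bsub>M\<^esub> x, r \<odot>\<^bsub>N\<^esub> y)" for x x' y y' r
    by (simp_all add: Q_def)
  have eQ: "e (x, y) \<in> carrier Q" if "x \<in> carrier M" "y \<in> carrier N" for x y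
    using that by (simp add: Q_def)
  let ?i = "restrict (\<lambda>x. e (x, \<zero>\<^bsub>N\<^esub>)) (carrier M)" and ?j = "restrict (\<lambda>y. e (\<zero>\<^bsub>M\<^esub>, y)) (carrier N)"
  let ?p = "restrict (\<lambda>z. fst (d z)) (carrier Q)" and ?q = "restrict (\<lambda>z. snd (d z)) (carrier Q)"
  show thesis
  proof
    show "module R Q"
    proof (rule moduleI)
      show "abelian_group Q"
      proof (rule abelian_groupI)
        fix z assume "z \<in> carrier Q"
        then obtain x y where z: "x \<in> carrier M" "y \<in> carrier N" "z = e (x, y)" by (rule carrE)
        then show "\<exists>w\<in>carrier Q. w \<oplus>\<^bsub>Q\<^esub> z = \<zero>\<^bsub>Q\<^esub>"
          by (intro bexI[of _ "e (\<ominus>\<^bsub>M\<^esub> x, \<ominus>\<^bsub>N\<^esub> y)"])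
            (simp_all add: ops eQ M.M.l_neg N.M.l_neg)
      qed (auto simp: ops eQ M.M.a_ac N.M.a_ac elim!: carrE)
    qed (auto simp: ops eQ M.R.is_cring M.smult_l_distr N.smult_l_distr M.smult_r_distr
        N.smult_r_distr M.smult_assoc1 N.smult_assoc1 elim!: carrE)
    show "?i \<in> mod_hom R M Q" "?j \<in> mod_hom R N Q"
      by (rule mod_homI; simp add: ops eQ)+
    show "?p \<in> mod_hom R Q M" "?q \<in> mod_hom R Q N"
      by (rule mod_homI; auto simp: ops eQ inj_eq[OF \<open>inj e\<close>] elim!: carrE)+
  qed (auto simp: eQ ops elim!: carrE)
qed


section \<open>Chain maps\<close>

lemma mod_hom_zero_map:
  assumes "module R M" "module R N"
  shows "restrict (\<lambda>x. \<zero>\<^bsub>N\<^esub>) (carrier M) \<in> mod_hom R M N"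
proof -
  interpret M: module R M by fact
  interpret N: module R N by fact
  show ?thesis by (rule mod_homI) simp_all
qed

lemma mod_hom_plus:
  assumes "module R M" "module R N" "f \<in> mod_hom R M N" "g \<in> mod_hom R M N"
  shows "restrict (\<lambda>x. f x \<oplus>\<^bsub>N\<^esub> g x) (carrier M) \<in> mod_hom R M N"
proof -
  interpret M: module R M by fact
  interpret N: module R N by fact
  show ?thesis
    by (rule mod_homI)
      (simp_all add: mod_hom_closed[OF assms(3)] mod_hom_closed[OF assms(4)]
        mod_hom_add[OF assms(3)] mod_hom_add[OF assms(4)] mod_hom_smult[OF assms(3)]
        mod_hom_smult[OF assms(4)] N.smult_r_distr N.M.a_ac)
qed

lemma mod_hom_uminus:
  assumes "module R M" "module R N" "f \<in> mod_hom R M N"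
  shows "restrict (\<lambda>x. \<ominus>\<^bsub>N\<^esub> f x) (carrier M) \<in> mod_hom R M N"
proof -
  interpret M: module R M by fact
  interpret N: module R N by fact
  show ?thesis
    by (rule mod_homI)
      (simp_all add: mod_hom_closed[OF assms(3)] mod_hom_add[OF assms(3)] mod_hom_smult[OF assms(3)]
        N.smult_r_minus N.M.minus_add)
qed

lemma chain_complexD:
  assumes "chain_complex R X"
  shows chain_complex_module: "module R (Mdl X n)"
    and chain_complex_diff: "Diff X n \<in> mod_hom R (Mdl X n) (Mdl X (n - 1))"
    and chain_complex_diff_diff:
      "x \<in> carrier (Mdl X n) \<Longrightarrow> Diff X (n - 1) (Diff X n x) = \<zero>\<^bsub>Mdl X (n - 1 - 1)\<^esub>"
  using assms by (simp_all add: chain_complex_def)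

lemma chain_mapsD:
  assumes "f \<in> chain_maps R X Y"
  shows chain_map_hom: "f n \<in> mod_hom R (Mdl X n) (Mdl Y n)"
    and chain_map_diff: "x \<in> carrier (Mdl X n) \<Longrightarrow> Diff Y n (f n x) = f (n - 1) (Diff X n x)"
  using assms by (simp_all add: chain_maps_def)

lemma chain_mapsI:
  assumes "\<And>n. f n \<in> mod_hom R (Mdl X n) (Mdl Y n)"
    and "\<And>n x. x \<in> carrier (Mdl X n) \<Longrightarrow> Diff Y n (f n x) = f (n - 1) (Diff X n x)"
  shows "f \<in> chain_maps R X Y"
  using assms by (simp add: chain_maps_def)

lemma chain_map_closed:
  "\<lbrakk>f \<in> chain_maps R X Y; x \<in> carrier (Mdl X n)\<rbrakk> \<Longrightarrow> f n x \<in> carrier (Mdl Y n)"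
  using mod_hom_closed[OF chain_map_hom] .

lemma diff_closed:
  "\<lbrakk>chain_complex R X; x \<in> carrier (Mdl X n)\<rbrakk> \<Longrightarrow> Diff X n x \<in> carrier (Mdl X (n - 1))"
  using mod_hom_closed[OF chain_complex_diff] .

lemma chain_map_zero:
  "\<lbrakk>chain_complex R X; chain_complex R Y; f \<in> chain_maps R X Y\<rbrakk> \<Longrightarrow> f n \<zero>\<^bsub>Mdl X n\<^esub> = \<zero>\<^bsub>Mdl Y n\<^esub>"
  by (rule mod_hom_zero[OF chain_complex_module chain_complex_module chain_map_hom])

lemma diff_zero: "chain_complex R X \<Longrightarrow> Diff X n \<zero>\<^bsub>Mdl X n\<^esub> = \<zero>\<^bsub>Mdl X (n - 1)\<^esub>"
  by (rule mod_hom_zero[OF chain_complex_module chain_complex_module chain_complex_diff])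

lemma chain_map_eqI:
  assumes "f \<in> chain_maps R X Y" "g \<in> chain_maps R X Y'"
    and "\<And>n x. x \<in> carrier (Mdl X n) \<Longrightarrow> f n x = g n x"
  shows "f = g"
proof
  show "f n = g n" for n
    by (rule mod_hom_eqI[OF chain_map_hom[OF assms(1)] chain_map_hom[OF assms(2)] assms(3)])
qed

lemma chain_map_id:
  assumes "chain_complex R X"
  shows "(\<lambda>n. restrict id (carrier (Mdl X n))) \<in> chain_maps R X X"
  by (rule chain_mapsI)
    (use assms in \<open>simp_all add: mod_hom_id chain_complex_module diff_closed\<close>)

lemma chain_map_comp:
  assumes "chain_complex R X" "f \<in> chain_maps R X Y" "g \<in> chain_maps R Y Z"
  shows "(\<lambda>n. compose (carrier (Mdl X n)) (g n) (f n)) \<in> chain_maps R X Z"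
proof (rule chain_mapsI)
  show "compose (carrier (Mdl X n)) (g n) (f n) \<in> mod_hom R (Mdl X n) (Mdl Z n)" for n
    by (rule mod_hom_compose[OF chain_complex_module[OF assms(1)] chain_map_hom[OF assms(2)]
          chain_map_hom[OF assms(3)]])
qed (simp add: compose_eq diff_closed[OF assms(1)] chain_map_diff[OF assms(2)]
    chain_map_diff[OF assms(3)] chain_map_closed[OF assms(2)])

lemma chain_map_zero_map:
  assumes "chain_complex R X" "chain_complex R Y"
  shows "(\<lambda>n. restrict (\<lambda>x. \<zero>\<^bsub>Mdl Y n\<^esub>) (carrier (Mdl X n))) \<in> chain_maps R X Y"
  by (rule chain_mapsI)
    (use assms in \<open>simp_all add: mod_hom_zero_map chain_complex_module diff_closed diff_zero\<close>)

lemma chain_map_plus: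
  assumes "chain_complex R X" "chain_complex R Y" "f \<in> chain_maps R X Y" "g \<in> chain_maps R X Y"
  shows "(\<lambda>n. restrict (\<lambda>x. f n x \<oplus>\<^bsub>Mdl Y n\<^esub> g n x) (carrier (Mdl X n))) \<in> chain_maps R X Y"
  by (rule chain_mapsI)
    (use assms in \<open>simp_all add: mod_hom_plus chain_complex_module chain_map_hom diff_closed
      mod_hom_add[OF chain_complex_diff[OF assms(2)]] chain_map_closed chain_map_diff\<close>)

lemma chain_map_uminus:
  assumes "chain_complex R X" "chain_complex R Y" "f \<in> chain_maps R X Y"
  shows "(\<lambda>n. restrict (\<lambda>x. \<ominus>\<^bsub>Mdl Y n\<^esub> f n x) (carrier (Mdl X n))) \<in> chain_maps R X Y"
proof -
  note Y = chain_complex_module[OF assms(2)]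
  show ?thesis
    by (rule chain_mapsI)
      (use assms in \<open>simp_all add: mod_hom_uminus chain_complex_module chain_map_hom diff_closed
        mod_hom_minus[OF Y Y chain_complex_diff[OF assms(2)]] chain_map_closed chain_map_diff\<close>)
qed

lemma subcategory_simps [simp]:
  "Obj (full_subcategory (complex_category R) S) = {X. chain_complex R X} \<inter> S"
  "Hom (full_subcategory (complex_category R) S) = chain_maps R"
  "Idn (full_subcategory (complex_category R) S) X = (\<lambda>n. restrict id (carrier (Mdl X n)))"
  "Cmp (full_subcategory (complex_category R) S) X Y Z g f
    = (\<lambda>n. compose (carrier (Mdl X n)) (g n) (f n))"
  "HAdd (full_subcategory (complex_category R) S) X Y f g
    = (\<lambda>n. restrict (\<lambda>x. f n x \<oplus>\<^bsub>Mdl Y n\<^esub> g n x) (carrier (Mdl X n)))"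
  "HZero (full_subcategory (complex_category R) S) X Y
    = (\<lambda>n. restrict (\<lambda>x. \<zero>\<^bsub>Mdl Y n\<^esub>) (carrier (Mdl X n)))"
  by (simp_all add: full_subcategory_def complex_category_def)

lemma comm_group_chain_maps:
  assumes X: "chain_complex R X" and Y: "chain_complex R Y"
  shows "comm_group (hom_group (full_subcategory (complex_category R) S) X Y)"
proof -
  interpret Y: module R "Mdl Y n" for n by (rule chain_complex_module[OF Y])
  note closed = chain_map_closed[of _ R X Y]
  note plus = chain_map_plus[OF X Y] and zero = chain_map_zero_map[OF X Y]
    and uminus = chain_map_uminus[OF X Y]
  let ?G = "hom_group (full_subcategory (complex_category R) S) X Y"
  show ?thesis
  proof (rule comm_groupI)
    show "\<one>\<^bsub>?G\<^esub> \<in> carrier ?G" using zero by simp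
    fix f assume "f \<in> carrier ?G"
    then have f: "f \<in> chain_maps R X Y" by simp
    show "\<one>\<^bsub>?G\<^esub> \<otimes>\<^bsub>?G\<^esub> f = f"
      unfolding subcategory_simps monoid.simps
      by (rule chain_map_eqI[OF plus[OF zero f] f]) (simp add: closed[OF f])
    show "\<exists>g\<in>carrier ?G. g \<otimes>\<^bsub>?G\<^esub> f = \<one>\<^bsub>?G\<^esub>"
      unfolding subcategory_simps monoid.simps partial_object.simps
      by (rule rev_bexI[OF uminus[OF f]], rule chain_map_eqI[OF plus[OF uminus[OF f] f] zero])
        (simp add: closed[OF f] Y.M.l_neg)
    fix g assume "g \<in> carrier ?G"
    then have g: "g \<in> chain_maps R X Y" by simp
    show "f \<otimes>\<^bsub>?G\<^esub> g \<in> carrier ?G" using plus[OF f g] by simp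
    show "f \<otimes>\<^bsub>?G\<^esub> g = g \<otimes>\<^bsub>?G\<^esub> f"
      unfolding subcategory_simps monoid.simps
      by (rule chain_map_eqI[OF plus[OF f g] plus[OF g f]])
        (simp add: closed[OF f] closed[OF g] Y.M.a_comm)
    fix h assume "h \<in> carrier ?G"
    then have h: "h \<in> chain_maps R X Y" by simp
    show "f \<otimes>\<^bsub>?G\<^esub> g \<otimes>\<^bsub>?G\<^esub> h = f \<otimes>\<^bsub>?G\<^esub> (g \<otimes>\<^bsub>?G\<^esub> h)"
      unfolding subcategory_simps monoid.simps
      by (rule chain_map_eqI[OF plus[OF plus[OF f g] h] plus[OF f plus[OF g h]]])
        (simp add: closed[OF f] closed[OF g] closed[OF h] Y.M.a_assoc)
  qed
qed

text \<open>
  The axioms of a preadditive category concern only the arrows between given objects, so they hold in every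
  full subcategory of the category of complexes.
\<close>

lemma preadditive_full_subcategory:
  "preadditive_category (full_subcategory (complex_category R) S)"
proof (rule preadditive_category.intro[OF category.intro preadditive_category_axioms.intro])
  let ?C = "full_subcategory (complex_category R) S"
  show "Idn ?C X \<in> Hom ?C X X" if "X \<in> Obj ?C" for X
    using that by (simp add: chain_map_id)
  show "comm_group (hom_group ?C X Y)" if "X \<in> Obj ?C" "Y \<in> Obj ?C" for X Y
    by (rule comm_group_chain_maps) (use that in simp_all)
  fix X Y f assume "X \<in> Obj ?C" "Y \<in> Obj ?C" "f \<in> Hom ?C X Y"
  then have X: "chain_complex R X" and Y: "chain_complex R Y" and f: "f \<in> chain_maps R X Y"
    by simp_all
  show "Cmp ?C X X Y f (Idn ?C X) = f"
    unfolding subcategory_simps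
    by (rule chain_map_eqI[OF chain_map_comp[OF X chain_map_id[OF X] f] f]) (simp add: compose_eq)
  show "Cmp ?C X Y Y (Idn ?C Y) f = f"
    unfolding subcategory_simps
    by (rule chain_map_eqI[OF chain_map_comp[OF X f chain_map_id[OF Y]] f])
      (simp add: compose_eq chain_map_closed[OF f])
  fix Z g assume "Z \<in> Obj ?C" "g \<in> Hom ?C Y Z"
  then have Z: "chain_complex R Z" and g: "g \<in> chain_maps R Y Z" by simp_all
  show "Cmp ?C X Y Z g f \<in> Hom ?C X Z"
    unfolding subcategory_simps by (rule chain_map_comp[OF X f g])
  show "Cmp ?C X Y Z g (HAdd ?C X Y f f') = HAdd ?C X Z (Cmp ?C X Y Z g f) (Cmp ?C X Y Z g f')"
    if "f' \<in> Hom ?C X Y" for f'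
  proof -
    have f': "f' \<in> chain_maps R X Y" using that by simp
    show ?thesis
      unfolding subcategory_simps
      by (rule chain_map_eqI[OF chain_map_comp[OF X chain_map_plus[OF X Y f f'] g]
            chain_map_plus[OF X Z chain_map_comp[OF X f g] chain_map_comp[OF X f' g]]])
        (simp add: compose_eq chain_map_closed[OF f] chain_map_closed[OF f']
          mod_hom_add[OF chain_map_hom[OF g]])
  qed
  show "Cmp ?C X Y Z (HAdd ?C Y Z g g') f = HAdd ?C X Z (Cmp ?C X Y Z g f) (Cmp ?C X Y Z g' f)"
    if "g' \<in> Hom ?C Y Z" for g'
  proof -
    have g': "g' \<in> chain_maps R Y Z" using that by simp
    show ?thesis
      unfolding subcategory_simps
      by (rule chain_map_eqI[OF chain_map_comp[OF X f chain_map_plus[OF Y Z g g']]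
            chain_map_plus[OF X Z chain_map_comp[OF X f g] chain_map_comp[OF X f g']]])
        (simp add: compose_eq chain_map_closed[OF f])
  qed
  fix W h assume "W \<in> Obj ?C" "h \<in> Hom ?C Z W"
  then have h: "h \<in> chain_maps R Z W" by simp
  show "Cmp ?C X Z W h (Cmp ?C X Y Z g f) = Cmp ?C X Y W (Cmp ?C Y Z W h g) f"
    unfolding subcategory_simps
    by (rule chain_map_eqI[OF chain_map_comp[OF X chain_map_comp[OF X f g] h]
          chain_map_comp[OF X f chain_map_comp[OF Y g h]]])
      (simp add: compose_eq chain_map_closed[OF f])
qed


section \<open>Kernels, cokernels and direct sums of complexes\<close>

text \<open>
  A degreewise factorization through an injective or surjective chain map is automatically a chain map: it
  commutes with the differentials after composing with the map, which can be cancelled.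
\<close>

lemma chain_map_factor_inj:
  assumes K: "chain_complex R K" and X: "chain_complex R X" and T: "chain_complex R T"
    and k: "k \<in> chain_maps R K X" and inj: "\<And>n. inj_on (k n) (carrier (Mdl K n))"
    and t: "t \<in> chain_maps R T X"
    and sub: "\<And>n. t n ` carrier (Mdl T n) \<subseteq> k n ` carrier (Mdl K n)"
  obtains u where "u \<in> chain_maps R T K"
    "\<And>n x. x \<in> carrier (Mdl T n) \<Longrightarrow> k n (u n x) = t n x"
proof -
  have "\<exists>u. u \<in> mod_hom R (Mdl T n) (Mdl K n) \<and> (\<forall>x\<in>carrier (Mdl T n). k n (u x) = t n x)" for n
    by (rule mod_hom_factor_inj[OF chain_complex_module[OF K] chain_complex_module[OF X]
          chain_complex_module[OF T] chain_map_hom[OF k] inj chain_map_hom[OF t] sub]) blast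
  then obtain u where u: "\<And>n. u n \<in> mod_hom R (Mdl T n) (Mdl K n)"
    and ku: "\<And>n x. x \<in> carrier (Mdl T n) \<Longrightarrow> k n (u n x) = t n x" by metis
  have "u \<in> chain_maps R T K"
  proof (rule chain_mapsI[OF u])
    fix n x assume x: "x \<in> carrier (Mdl T n)"
    note ux = mod_hom_closed[OF u x] and dx = diff_closed[OF T x]
    have "k (n - 1) (Diff K n (u n x)) = k (n - 1) (u (n - 1) (Diff T n x))"
      using ku[OF x] ku[OF dx] chain_map_diff[OF k ux] chain_map_diff[OF t x] by simp
    then show "Diff K n (u n x) = u (n - 1) (Diff T n x)"
      using inj_onD[OF inj] diff_closed[OF K ux] mod_hom_closed[OF u dx] by blast
  qed
  then show thesis using ku by (rule that)
qed

lemma chain_map_factor_surj: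
  assumes Y: "chain_complex R Y" and Q: "chain_complex R Q" and T: "chain_complex R T"
    and c: "c \<in> chain_maps R Y Q" and surj: "\<And>n. c n ` carrier (Mdl Y n) = carrier (Mdl Q n)"
    and t: "t \<in> chain_maps R Y T"
    and ker: "\<And>n y. \<lbrakk>y \<in> carrier (Mdl Y n); c n y = \<zero>\<^bsub>Mdl Q n\<^esub>\<rbrakk> \<Longrightarrow> t n y = \<zero>\<^bsub>Mdl T n\<^esub>"
  obtains u where "u \<in> chain_maps R Q T"
    "\<And>n y. y \<in> carrier (Mdl Y n) \<Longrightarrow> u n (c n y) = t n y"
proof -
  have "\<exists>u. u \<in> mod_hom R (Mdl Q n) (Mdl T n) \<and> (\<forall>y\<in>carrier (Mdl Y n). u (c n y) = t n y)" for n
    by (rule mod_hom_factor_surj[OF chain_complex_module[OF Y] chain_complex_module[OF Q]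
          chain_complex_module[OF T] chain_map_hom[OF c] surj chain_map_hom[OF t] ker]) blast+
  then obtain u where u: "\<And>n. u n \<in> mod_hom R (Mdl Q n) (Mdl T n)"
    and uc: "\<And>n y. y \<in> carrier (Mdl Y n) \<Longrightarrow> u n (c n y) = t n y" by metis
  have "u \<in> chain_maps R Q T"
  proof (rule chain_mapsI[OF u])
    fix n z assume "z \<in> carrier (Mdl Q n)"
    then obtain y where y: "y \<in> carrier (Mdl Y n)" "z = c n y" using surj[of n] by blast
    show "Diff T n (u n z) = u (n - 1) (Diff Q n z)"
      using uc[OF y(1)] uc[OF diff_closed[OF Y y(1)]] chain_map_diff[OF t y(1)]
        chain_map_diff[OF c y(1)] y(2) by simp
  qed
  then show thesis using uc by (rule that)
qed

text \<open>
  Degreewise criteria for kernels and cokernels. The set \<open>S\<close> of objects is arbitrary, for a full subcategory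
  inherits each universal property whose representing object it contains.
\<close>

lemma is_kernelI:
  assumes X: "chain_complex R X" and Y: "chain_complex R Y"
    and K: "chain_complex R K" "K \<in> S"
    and f: "f \<in> chain_maps R X Y" and k: "k \<in> chain_maps R K X"
    and inj: "\<And>n. inj_on (k n) (carrier (Mdl K n))"
    and img: "\<And>n. k n ` carrier (Mdl K n) = {x \<in> carrier (Mdl X n). f n x = \<zero>\<^bsub>Mdl Y n\<^esub>}"
  shows "is_kernel (full_subcategory (complex_category R) S) X Y f K k"
  unfolding is_kernel_def subcategory_simps
proof (intro conjI ballI impI)
  show "K \<in> {X. chain_complex R X} \<inter> S" using K by simp
  show "k \<in> chain_maps R K X" by (rule k)
  show "(\<lambda>n. compose (carrier (Mdl K n)) (f n) (k n))
      = (\<lambda>n. restrict (\<lambda>x. \<zero>\<^bsub>Mdl Y n\<^esub>) (carrier (Mdl K n)))"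
    by (rule chain_map_eqI[OF chain_map_comp[OF K(1) k f] chain_map_zero_map[OF K(1) Y]])
      (use img in \<open>auto simp: compose_eq\<close>)
  fix T t
  assume "T \<in> {X. chain_complex R X} \<inter> S" and t: "t \<in> chain_maps R T X"
    and ft: "(\<lambda>n. compose (carrier (Mdl T n)) (f n) (t n))
      = (\<lambda>n. restrict (\<lambda>x. \<zero>\<^bsub>Mdl Y n\<^esub>) (carrier (Mdl T n)))"
  then have T: "chain_complex R T" by simp
  have "f n (t n x) = \<zero>\<^bsub>Mdl Y n\<^esub>" if "x \<in> carrier (Mdl T n)" for n x
    using fun_cong[OF fun_cong[OF ft, of n], of x] that by (simp add: compose_eq)
  then have sub: "t n ` carrier (Mdl T n) \<subseteq> k n ` carrier (Mdl K n)" for n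
    unfolding img using chain_map_closed[OF t] by auto
  obtain u where u: "u \<in> chain_maps R T K"
    and ku: "\<And>n x. x \<in> carrier (Mdl T n) \<Longrightarrow> k n (u n x) = t n x"
    by (rule chain_map_factor_inj[OF K(1) X T k inj t sub]) blast
  show "\<exists>!u. u \<in> chain_maps R T K \<and> (\<lambda>n. compose (carrier (Mdl T n)) (k n) (u n)) = t"
  proof (intro ex1I conjI)
    show "u \<in> chain_maps R T K" by (rule u)
    show "(\<lambda>n. compose (carrier (Mdl T n)) (k n) (u n)) = t"
      by (rule chain_map_eqI[OF chain_map_comp[OF T u k] t]) (simp add: compose_eq ku)
  next
    fix v assume "v \<in> chain_maps R T K \<and> (\<lambda>n. compose (carrier (Mdl T n)) (k n) (v n)) = t"
    then have v: "v \<in> chain_maps R T K" and kv: "(\<lambda>n. compose (carrier (Mdl T n)) (k n) (v n)) = t"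
      by auto
    show "v = u"
    proof (rule chain_map_eqI[OF v u])
      fix n x assume x: "x \<in> carrier (Mdl T n)"
      have "k n (v n x) = k n (u n x)"
        using fun_cong[OF fun_cong[OF kv, of n], of x] ku[OF x] x by (simp add: compose_eq)
      then show "v n x = u n x"
        by (rule inj_onD[OF inj _ chain_map_closed[OF v x] chain_map_closed[OF u x]])
    qed
  qed
qed

lemma is_cokernelI:
  assumes X: "chain_complex R X" and Y: "chain_complex R Y"
    and Q: "chain_complex R Q" "Q \<in> S"
    and f: "f \<in> chain_maps R X Y" and c: "c \<in> chain_maps R Y Q"
    and surj: "\<And>n. c n ` carrier (Mdl Y n) = carrier (Mdl Q n)"
    and ker: "\<And>n y. y \<in> carrier (Mdl Y n) \<Longrightarrow>
      c n y = \<zero>\<^bsub>Mdl Q n\<^esub> \<longleftrightarrow> y \<in> f n ` carrier (Mdl X n)"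
  shows "is_cokernel (full_subcategory (complex_category R) S) X Y f Q c"
  unfolding is_cokernel_def subcategory_simps
proof (intro conjI ballI impI)
  show "Q \<in> {X. chain_complex R X} \<inter> S" using Q by simp
  show "c \<in> chain_maps R Y Q" by (rule c)
  show "(\<lambda>n. compose (carrier (Mdl X n)) (c n) (f n))
      = (\<lambda>n. restrict (\<lambda>x. \<zero>\<^bsub>Mdl Q n\<^esub>) (carrier (Mdl X n)))"
    by (rule chain_map_eqI[OF chain_map_comp[OF X f c] chain_map_zero_map[OF X Q(1)]])
      (simp add: compose_eq ker chain_map_closed[OF f])
  fix T t
  assume "T \<in> {X. chain_complex R X} \<inter> S" and t: "t \<in> chain_maps R Y T"
    and tf: "(\<lambda>n. compose (carrier (Mdl X n)) (t n) (f n))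
      = (\<lambda>n. restrict (\<lambda>x. \<zero>\<^bsub>Mdl T n\<^esub>) (carrier (Mdl X n)))"
  then have T: "chain_complex R T" by simp
  have "t n (f n x) = \<zero>\<^bsub>Mdl T n\<^esub>" if "x \<in> carrier (Mdl X n)" for n x
    using fun_cong[OF fun_cong[OF tf, of n], of x] that by (simp add: compose_eq)
  then have t0: "t n y = \<zero>\<^bsub>Mdl T n\<^esub>" if "y \<in> carrier (Mdl Y n)" "c n y = \<zero>\<^bsub>Mdl Q n\<^esub>" for n y
    using that ker by auto
  obtain u where u: "u \<in> chain_maps R Q T"
    and uc: "\<And>n y. y \<in> carrier (Mdl Y n) \<Longrightarrow> u n (c n y) = t n y"
    by (rule chain_map_factor_surj[OF Y Q(1) T c surj t t0]) blast+
  show "\<exists>!u. u \<in> chain_maps R Q T \<and> (\<lambda>n. compose (carrier (Mdl Y n)) (u n) (c n)) = t"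
  proof (intro ex1I conjI)
    show "u \<in> chain_maps R Q T" by (rule u)
    show "(\<lambda>n. compose (carrier (Mdl Y n)) (u n) (c n)) = t"
      by (rule chain_map_eqI[OF chain_map_comp[OF Y c u] t]) (simp add: compose_eq uc)
  next
    fix v assume "v \<in> chain_maps R Q T \<and> (\<lambda>n. compose (carrier (Mdl Y n)) (v n) (c n)) = t"
    then have v: "v \<in> chain_maps R Q T" and vc: "(\<lambda>n. compose (carrier (Mdl Y n)) (v n) (c n)) = t"
      by auto
    show "v = u"
    proof (rule chain_map_eqI[OF v u])
      fix n z assume "z \<in> carrier (Mdl Q n)"
      then obtain y where y: "y \<in> carrier (Mdl Y n)" "z = c n y" using surj[of n] by blast
      show "v n z = u n z"
        using fun_cong[OF fun_cong[OF vc, of n], of y] uc[OF y(1)] y by (simp add: compose_eq)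
    qed
  qed
qed

lemma kernel_complex:
  fixes X Y :: "('r, 'm) chain_cplx"
  assumes X: "chain_complex R X" and Y: "chain_complex R Y" and f: "f \<in> chain_maps R X Y"
  obtains K :: "('r, 'm) chain_cplx" and k where "chain_complex R K" "k \<in> chain_maps R K X"
    "\<And>n. inj_on (k n) (carrier (Mdl K n))"
    "\<And>n. k n ` carrier (Mdl K n) = {x \<in> carrier (Mdl X n). f n x = \<zero>\<^bsub>Mdl Y n\<^esub>}"
proof
  let ?Z = "\<lambda>n. {x \<in> carrier (Mdl X n). f n x = \<zero>\<^bsub>Mdl Y n\<^esub>}"
  let ?K = "\<lparr>Mdl = \<lambda>n. (Mdl X n)\<lparr>carrier := ?Z n\<rparr>, Diff = \<lambda>n. restrict (Diff X n) (?Z n)\<rparr>"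
  let ?k = "\<lambda>n. restrict id (?Z n)"
  have "submodule (?Z n) R (Mdl X n)" for n
    by (rule kernel_submodule[OF chain_complex_module[OF X] chain_complex_module[OF Y]
          chain_map_hom[OF f]])
  then have mod: "module R ((Mdl X n)\<lparr>carrier := ?Z n\<rparr>)" for n
    by (rule submodule.submodule_is_module[OF _ chain_complex_module[OF X]])
  interpret Kn: module R "(Mdl X n)\<lparr>carrier := ?Z n\<rparr>" for n by (rule mod)
  have add: "x \<oplus>\<^bsub>Mdl X n\<^esub> y \<in> ?Z n" if "x \<in> ?Z n" "y \<in> ?Z n" for n x y
    using Kn.M.a_closed[of x n y] that by simp
  have smult: "r \<odot>\<^bsub>Mdl X n\<^esub> x \<in> ?Z n" if "r \<in> carrier R" "x \<in> ?Z n" for n r x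
    using Kn.smult_closed[of r x n] that by simp
  have diff: "Diff X n x \<in> ?Z (n - 1)" if "x \<in> ?Z n" for n x
    using that chain_map_diff[OF f, of x n] diff_closed[OF X] diff_zero[OF Y] by auto
  show "chain_complex R ?K"
    unfolding chain_complex_def
  proof (intro conjI allI ballI)
    show "module R (Mdl ?K n)" for n using mod by simp
    show "Diff ?K n \<in> mod_hom R (Mdl ?K n) (Mdl ?K (n - 1))" for n
      by (rule mod_homI) (use diff add smult in
        \<open>simp_all add: mod_hom_add[OF chain_complex_diff[OF X]] mod_hom_smult[OF chain_complex_diff[OF X]]\<close>)
    show "Diff ?K (n - 1) (Diff ?K n x) = \<zero>\<^bsub>Mdl ?K (n - 1 - 1)\<^esub>" if "x \<in> carrier (Mdl ?K n)" for n x
      using that diff[of x n] chain_complex_diff_diff[OF X, of x n] by simp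
  qed
  show "?k \<in> chain_maps R ?K X"
  proof (rule chain_mapsI)
    show "?k n \<in> mod_hom R (Mdl ?K n) (Mdl X n)" for n
      by (rule mod_homI) (use add smult in simp_all)
    show "Diff X n (?k n x) = ?k (n - 1) (Diff ?K n x)" if "x \<in> carrier (Mdl ?K n)" for n x
      using that diff[of x n] by simp
  qed
  show "inj_on (?k n) (carrier (Mdl ?K n))" for n by (simp add: inj_on_def)
  show "?k n ` carrier (Mdl ?K n) = ?Z n" for n by simp
qed

text \<open>
  The differential of \<open>Y\<close> descends to the degreewise quotients because \<open>f\<close> is a chain map, so that the
  differential maps the image of \<open>f\<close> into itself.
\<close>

lemma cokernel_complex:
  fixes X Y :: "('r, 'm) chain_cplx"
  assumes X: "chain_complex R X" and Y: "chain_complex R Y" and f: "f \<in> chain_maps R X Y"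
  obtains Q :: "('r, 'm) chain_cplx" and c where "chain_complex R Q" "c \<in> chain_maps R Y Q"
    "\<And>n. c n ` carrier (Mdl Y n) = carrier (Mdl Q n)"
    "\<And>n y. y \<in> carrier (Mdl Y n) \<Longrightarrow> c n y = \<zero>\<^bsub>Mdl Q n\<^esub> \<longleftrightarrow> y \<in> f n ` carrier (Mdl X n)"
proof -
  let ?good = "\<lambda>n (N :: ('r, 'm) module) c. module R N \<and> c \<in> mod_hom R (Mdl Y n) N \<and>
    c ` carrier (Mdl Y n) = carrier N \<and>
    (\<forall>y\<in>carrier (Mdl Y n). c y = \<zero>\<^bsub>N\<^esub> \<longleftrightarrow> y \<in> f n ` carrier (Mdl X n))"
  have "\<exists>N c. ?good n N c" for n
    by (rule quotient_on_same_type[OF chain_complex_module[OF Y] image_submodule[OF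
            chain_complex_module[OF X] chain_complex_module[OF Y] chain_map_hom[OF f]]]) blast
  then obtain N c where good: "\<And>n. ?good n (N n) (c n)" by metis
  then have N: "module R (N n)" and c: "c n \<in> mod_hom R (Mdl Y n) (N n)"
    and surj: "c n ` carrier (Mdl Y n) = carrier (N n)"
    and ker: "y \<in> carrier (Mdl Y n) \<Longrightarrow> c n y = \<zero>\<^bsub>N n\<^esub> \<longleftrightarrow> y \<in> f n ` carrier (Mdl X n)" for n y
    by blast+
  \<comment> \<open>the differential of the quotient, in degree \<open>n\<close>\<close>
  have "\<exists>d. d \<in> mod_hom R (N n) (N (n - 1)) \<and>
    (\<forall>y\<in>carrier (Mdl Y n). d (c n y) = c (n - 1) (Diff Y n y))" for n
  proof -
    let ?t = "compose (carrier (Mdl Y n)) (c (n - 1)) (Diff Y n)"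
    have "?t \<in> mod_hom R (Mdl Y n) (N (n - 1))"
      by (rule mod_hom_compose[OF chain_complex_module[OF Y] chain_complex_diff[OF Y] c])
    moreover have "?t y = \<zero>\<^bsub>N (n - 1)\<^esub>" if y: "y \<in> carrier (Mdl Y n)" "c n y = \<zero>\<^bsub>N n\<^esub>" for y
    proof -
      obtain x where x: "x \<in> carrier (Mdl X n)" "y = f n x" using ker y by blast
      then have "Diff Y n y \<in> f (n - 1) ` carrier (Mdl X (n - 1))"
        using chain_map_diff[OF f x(1)] diff_closed[OF X x(1)] by simp
      then show ?thesis using ker[OF diff_closed[OF Y y(1)]] y(1) by (simp add: compose_eq)
    qed
    ultimately obtain d where "d \<in> mod_hom R (N n) (N (n - 1))"
        "\<And>y. y \<in> carrier (Mdl Y n) \<Longrightarrow> d (c n y) = ?t y"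
      using mod_hom_factor_surj[OF chain_complex_module[OF Y] N N c surj] by metis
    then show ?thesis by (metis compose_eq)
  qed
  then obtain d where d: "\<And>n. d n \<in> mod_hom R (N n) (N (n - 1))"
    and dc: "\<And>n y. y \<in> carrier (Mdl Y n) \<Longrightarrow> d n (c n y) = c (n - 1) (Diff Y n y)"
    by metis
  let ?Q = "\<lparr>Mdl = N, Diff = d\<rparr>"
  show thesis
  proof
    show "chain_complex R ?Q"
      unfolding chain_complex_def
    proof (intro conjI allI ballI)
      fix n z assume "z \<in> carrier (Mdl ?Q n)"
      then obtain y where y: "y \<in> carrier (Mdl Y n)" "z = c n y" using surj[of n] by auto
      show "Diff ?Q (n - 1) (Diff ?Q n z) = \<zero>\<^bsub>Mdl ?Q (n - 1 - 1)\<^esub>"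
        using dc[OF y(1)] dc[OF diff_closed[OF Y y(1)]] y chain_complex_diff_diff[OF Y y(1)]
          mod_hom_zero[OF chain_complex_module[OF Y] N c]
        by simp
    qed (simp_all add: N d)
    show "c \<in> chain_maps R Y ?Q" by (rule chain_mapsI) (simp_all add: c dc)
  qed (simp_all add: surj ker)
qed

lemma direct_sum_complex:
  fixes X Y :: "('r, 'm) chain_cplx"
  assumes inf: "infinite (UNIV :: 'm set)" and X: "chain_complex R X" and Y: "chain_complex R Y"
  obtains P :: "('r, 'm) chain_cplx" and i j p q where "chain_complex R P"
    "i \<in> chain_maps R X P" "j \<in> chain_maps R Y P" "p \<in> chain_maps R P X" "q \<in> chain_maps R P Y"
    "\<And>n x. x \<in> carrier (Mdl X n) \<Longrightarrow> p n (i n x) = x"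
    "\<And>n y. y \<in> carrier (Mdl Y n) \<Longrightarrow> q n (j n y) = y"
    "\<And>n x. x \<in> carrier (Mdl X n) \<Longrightarrow> q n (i n x) = \<zero>\<^bsub>Mdl Y n\<^esub>"
    "\<And>n y. y \<in> carrier (Mdl Y n) \<Longrightarrow> p n (j n y) = \<zero>\<^bsub>Mdl X n\<^esub>"
    "\<And>n z. z \<in> carrier (Mdl P n) \<Longrightarrow> i n (p n z) \<oplus>\<^bsub>Mdl P n\<^esub> j n (q n z) = z"
proof -
  note Xm = chain_complex_module[OF X] and Ym = chain_complex_module[OF Y]
  let ?good = "\<lambda>n (N :: ('r, 'm) module) i j p q. module R N \<and>
    i \<in> mod_hom R (Mdl X n) N \<and> j \<in> mod_hom R (Mdl Y n) N \<and>
    p \<in> mod_hom R N (Mdl X n) \<and> q \<in> mod_hom R N (Mdl Y n) \<and>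
    (\<forall>x\<in>carrier (Mdl X n). p (i x) = x) \<and> (\<forall>y\<in>carrier (Mdl Y n). q (j y) = y) \<and>
    (\<forall>x\<in>carrier (Mdl X n). q (i x) = \<zero>\<^bsub>Mdl Y n\<^esub>) \<and>
    (\<forall>y\<in>carrier (Mdl Y n). p (j y) = \<zero>\<^bsub>Mdl X n\<^esub>) \<and>
    (\<forall>z\<in>carrier N. i (p z) \<oplus>\<^bsub>N\<^esub> j (q z) = z)"
  have "\<exists>N i j p q. ?good n N i j p q" for n
    by (rule direct_sum_on_same_type[OF inf Xm[of n] Ym[of n]]) blast
  then obtain N i j p q where good: "\<And>n. ?good n (N n) (i n) (j n) (p n) (q n)" by metis
  then have N: "module R (N n)"
    and i: "i n \<in> mod_hom R (Mdl X n) (N n)" and j: "j n \<in> mod_hom R (Mdl Y n) (N n)"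
    and p: "p n \<in> mod_hom R (N n) (Mdl X n)" and q: "q n \<in> mod_hom R (N n) (Mdl Y n)"
    and pi: "x \<in> carrier (Mdl X n) \<Longrightarrow> p n (i n x) = x"
    and qj: "y \<in> carrier (Mdl Y n) \<Longrightarrow> q n (j n y) = y"
    and qi: "x \<in> carrier (Mdl X n) \<Longrightarrow> q n (i n x) = \<zero>\<^bsub>Mdl Y n\<^esub>"
    and pj: "y \<in> carrier (Mdl Y n) \<Longrightarrow> p n (j n y) = \<zero>\<^bsub>Mdl X n\<^esub>"
    and sum: "z \<in> carrier (N n) \<Longrightarrow> i n (p n z) \<oplus>\<^bsub>N n\<^esub> j n (q n z) = z" for n x y z
    by blast+
  interpret N: module R "N n" for n by (rule N)
  interpret X: module R "Mdl X n" for n by (rule Xm)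
  interpret Y: module R "Mdl Y n" for n by (rule Ym)
  note closed = mod_hom_closed[OF i] mod_hom_closed[OF j] mod_hom_closed[OF p] mod_hom_closed[OF q]
    diff_closed[OF X] diff_closed[OF Y]
  note zero = mod_hom_zero[OF Xm N i] mod_hom_zero[OF Ym N j]
  \<comment> \<open>the differential \<open>i \<circ> d\<^sub>X \<circ> p + j \<circ> d\<^sub>Y \<circ> q\<close>, written as a
      composite of homomorphisms\<close>
  define d where "d n = restrict (\<lambda>z.
      compose (carrier (N n)) (compose (carrier (Mdl X n)) (i (n - 1)) (Diff X n)) (p n) z
      \<oplus>\<^bsub>N (n - 1)\<^esub>
      compose (carrier (N n)) (compose (carrier (Mdl Y n)) (j (n - 1)) (Diff Y n)) (q n) z)
    (carrier (N n))" for n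
  have d: "d n \<in> mod_hom R (N n) (N (n - 1))" for n
    unfolding d_def
    by (intro mod_hom_plus mod_hom_compose[where N = "Mdl X n"] mod_hom_compose[where N = "Mdl Y n"]
        mod_hom_compose[where N = "Mdl X (n - 1)"] mod_hom_compose[where N = "Mdl Y (n - 1)"]
        N Xm Ym i j p q chain_complex_diff[OF X] chain_complex_diff[OF Y])
  have d_eq: "d n z = i (n - 1) (Diff X n (p n z)) \<oplus>\<^bsub>N (n - 1)\<^esub> j (n - 1) (Diff Y n (q n z))"
    if "z \<in> carrier (N n)" for n z
    using that closed by (simp add: d_def compose_eq)
  have pd: "p (n - 1) (d n z) = Diff X n (p n z)" if "z \<in> carrier (N n)" for n z
    using that by (simp add: d_eq closed mod_hom_add[OF p] pi pj)
  have qd: "q (n - 1) (d n z) = Diff Y n (q n z)" if "z \<in> carrier (N n)" for n z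
    using that by (simp add: d_eq closed mod_hom_add[OF q] qi qj)
  let ?P = "\<lparr>Mdl = N, Diff = d\<rparr>"
  show thesis
  proof
    show "chain_complex R ?P"
      unfolding chain_complex_def
    proof (intro conjI allI ballI)
      fix n z assume "z \<in> carrier (Mdl ?P n)"
      then have z: "z \<in> carrier (N n)" by simp
      show "Diff ?P (n - 1) (Diff ?P n z) = \<zero>\<^bsub>Mdl ?P (n - 1 - 1)\<^esub>"
        using z mod_hom_closed[OF d z] d_eq[of "d n z" "n - 1"] pd[OF z] qd[OF z]
          chain_complex_diff_diff[OF X, of "p n z" n] chain_complex_diff_diff[OF Y, of "q n z" n]
        by (simp add: closed zero)
    qed (simp_all add: N d)
    show "i \<in> chain_maps R X ?P"
      by (rule chain_mapsI) (simp_all add: i d_eq closed pi qi zero diff_zero[OF Y])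
    show "j \<in> chain_maps R Y ?P"
      by (rule chain_mapsI) (simp_all add: j d_eq closed pj qj zero diff_zero[OF X])
    show "p \<in> chain_maps R ?P X" by (rule chain_mapsI) (simp_all add: p pd)
    show "q \<in> chain_maps R ?P Y" by (rule chain_mapsI) (simp_all add: q qd)
  qed (simp_all add: pi qj qi pj sum)
qed

lemma zero_complex:
  assumes "cring R"
  obtains Z :: "('r, 'm) chain_cplx" where "chain_complex R Z" "\<And>n. carrier (Mdl Z n) = {\<zero>\<^bsub>Mdl Z n\<^esub>}"
proof
  interpret cring R by fact
  let ?O = "\<lparr>carrier = {undefined}, mult = undefined, one = undefined, zero = undefined,
    add = (\<lambda>_ _. undefined), smult = (\<lambda>_ _. undefined)\<rparr> :: ('r, 'm) module"
  let ?Z = "\<lparr>Mdl = \<lambda>n. ?O, Diff = \<lambda>n. restrict (\<lambda>_. undefined) {undefined}\<rparr>"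
  have "module R ?O"
    by (rule moduleI, rule is_cring, rule abelian_groupI) simp_all
  then show "chain_complex R ?Z"
    by (auto simp: chain_complex_def intro!: mod_homI)
  show "carrier (Mdl ?Z n) = {\<zero>\<^bsub>Mdl ?Z n\<^esub>}" for n by simp
qed


section \<open>Abelian categories of complexes over a class of modules\<close>

text \<open>
  Closure under submodules and under finite direct sums are combined into one condition: \<open>Q\<close> belongs to the
  class if it has a jointly injective pair of homomorphisms into members of the class. A submodule is the case of
  two equal injections, and a direct sum has its two projections.
\<close>

locale abelian_module_class =
  fixes R :: "('r, 'x) ring_scheme" and P :: "('r, 'm) module \<Rightarrow> bool"
  assumes cring: "cring R"
    and infinite_universe: "infinite (UNIV :: 'm set)"
    and zero_closed: "\<lbrakk>module R M; carrier M = {\<zero>\<^bsub>M\<^esub>}\<rbrakk> \<Longrightarrow> P M"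
    and pair_closed: "\<lbrakk>module R M; module R N; module R Q; P M; P N;
      p \<in> mod_hom R Q M; q \<in> mod_hom R Q N;
      \<And>x y. \<lbrakk>x \<in> carrier Q; y \<in> carrier Q; p x = p y; q x = q y\<rbrakk> \<Longrightarrow> x = y\<rbrakk> \<Longrightarrow> P Q"
    and quotient_closed: "\<lbrakk>module R M; module R N; P M; f \<in> mod_hom R M N;
      f ` carrier M = carrier N\<rbrakk> \<Longrightarrow> P N"
begin

definition complexes :: "('r, 'm) chain_cplx set"
  where "complexes = {X. \<forall>n. P (Mdl X n)}"

abbreviation complexes_category :: "(('r, 'm) chain_cplx, int \<Rightarrow> 'm \<Rightarrow> 'm) ab_precat"
  where "complexes_category \<equiv> full_subcategory (complex_category R) complexes"

lemma kernel_data: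
  assumes X: "chain_complex R X" "X \<in> complexes" and Y: "chain_complex R Y"
    and f: "f \<in> chain_maps R X Y"
  obtains K k where "chain_complex R K" "K \<in> complexes" "k \<in> chain_maps R K X"
    "\<And>n. inj_on (k n) (carrier (Mdl K n))"
    "\<And>n. k n ` carrier (Mdl K n) = {x \<in> carrier (Mdl X n). f n x = \<zero>\<^bsub>Mdl Y n\<^esub>}"
proof -
  obtain K :: "('r, 'm) chain_cplx" and k where K: "chain_complex R K" and k: "k \<in> chain_maps R K X"
    and inj: "\<And>n. inj_on (k n) (carrier (Mdl K n))"
    and img: "\<And>n. k n ` carrier (Mdl K n) = {x \<in> carrier (Mdl X n). f n x = \<zero>\<^bsub>Mdl Y n\<^esub>}"
    by (rule kernel_complex[OF X(1) Y f]) blast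
  have "P (Mdl K n)" for n
  proof (rule pair_closed[OF chain_complex_module[OF X(1)] chain_complex_module[OF X(1)]
        chain_complex_module[OF K] _ _ chain_map_hom[OF k] chain_map_hom[OF k]])
    show "x = y" if "x \<in> carrier (Mdl K n)" "y \<in> carrier (Mdl K n)" "k n x = k n y" for x y
      using that(3,1,2) by (rule inj_onD[OF inj])
  qed (use X(2) in \<open>simp_all add: complexes_def\<close>)
  then have "K \<in> complexes" by (simp add: complexes_def)
  with K show thesis using k inj img by (rule that)
qed

lemma cokernel_data:
  assumes X: "chain_complex R X" and Y: "chain_complex R Y" "Y \<in> complexes"
    and f: "f \<in> chain_maps R X Y"
  obtains Q c where "chain_complex R Q" "Q \<in> complexes" "c \<in> chain_maps R Y Q"
    "\<And>n. c n ` carrier (Mdl Y n) = carrier (Mdl Q n)"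
    "\<And>n y. y \<in> carrier (Mdl Y n) \<Longrightarrow> c n y = \<zero>\<^bsub>Mdl Q n\<^esub> \<longleftrightarrow> y \<in> f n ` carrier (Mdl X n)"
proof -
  obtain Q :: "('r, 'm) chain_cplx" and c where Q: "chain_complex R Q" and c: "c \<in> chain_maps R Y Q"
    and surj: "\<And>n. c n ` carrier (Mdl Y n) = carrier (Mdl Q n)"
    and ker: "\<And>n y. y \<in> carrier (Mdl Y n) \<Longrightarrow>
      c n y = \<zero>\<^bsub>Mdl Q n\<^esub> \<longleftrightarrow> y \<in> f n ` carrier (Mdl X n)"
    by (rule cokernel_complex[OF X Y(1) f]) blast
  have "P (Mdl Q n)" for n
    using Y(2) by (intro quotient_closed[OF chain_complex_module[OF Y(1)] chain_complex_module[OF Q]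
          _ chain_map_hom[OF c] surj]) (simp add: complexes_def)
  then have "Q \<in> complexes" by (simp add: complexes_def)
  with Q show thesis using c surj ker by (rule that)
qed

text \<open>
  The inclusion of the kernel and the zero map have the same composite with \<open>f\<close>, hence coincide. The kernel is a
  legitimate test object because it belongs to the class.
\<close>

lemma monic_imp_inj:
  assumes X: "chain_complex R X" "X \<in> complexes" and Y: "chain_complex R Y"
    and monic: "monic complexes_category X Y f"
  shows "inj_on (f n) (carrier (Mdl X n))"
proof -
  have f: "f \<in> chain_maps R X Y" using monic by (simp add: monic_def)
  obtain K k where K: "chain_complex R K" "K \<in> complexes" and k: "k \<in> chain_maps R K X"
    and img: "\<And>n. k n ` carrier (Mdl K n) = {x \<in> carrier (Mdl X n). f n x = \<zero>\<^bsub>Mdl Y n\<^esub>}"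
    by (rule kernel_data[OF X Y f]) blast
  let ?z = "\<lambda>n. restrict (\<lambda>x. \<zero>\<^bsub>Mdl X n\<^esub>) (carrier (Mdl K n))"
  note z = chain_map_zero_map[OF K(1) X(1)]
  have fk: "f n (k n x) = \<zero>\<^bsub>Mdl Y n\<^esub>" if "x \<in> carrier (Mdl K n)" for n x
    using img[of n] that by blast
  have "(\<lambda>n. compose (carrier (Mdl K n)) (f n) (k n)) = (\<lambda>n. compose (carrier (Mdl K n)) (f n) (?z n))"
    by (rule chain_map_eqI[OF chain_map_comp[OF K(1) k f] chain_map_comp[OF K(1) z f]])
      (simp add: compose_eq fk chain_map_zero[OF X(1) Y f])
  then have kz: "k = ?z" using monic K k z by (simp add: monic_def)
  have ker: "x = \<zero>\<^bsub>Mdl X n\<^esub>" if "x \<in> carrier (Mdl X n)" "f n x = \<zero>\<^bsub>Mdl Y n\<^esub>" for x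
  proof -
    have "x \<in> k n ` carrier (Mdl K n)" using that by (simp add: img)
    then show ?thesis unfolding kz by auto
  qed
  interpret X: module R "Mdl X n" by (rule chain_complex_module[OF X(1)])
  show ?thesis
  proof (rule inj_onI)
    fix x y assume xy: "x \<in> carrier (Mdl X n)" "y \<in> carrier (Mdl X n)" "f n x = f n y"
    then have "x \<ominus>\<^bsub>Mdl X n\<^esub> y = \<zero>\<^bsub>Mdl X n\<^esub>"
      using mod_hom_eq_iff[OF X.module_axioms chain_complex_module[OF Y] chain_map_hom[OF f] xy(1,2)]
      by (intro ker) simp_all
    then show "x = y" using module_diff_eq_zero_iff[OF X.module_axioms xy(1,2)] by simp
  qed
qed

text \<open>
  Dually, the projection to the cokernel and the zero map have the same composite with \<open>f\<close>, hence
  coincide.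
\<close>

lemma epic_imp_surj:
  assumes X: "chain_complex R X" and Y: "chain_complex R Y" "Y \<in> complexes"
    and epic: "epic complexes_category X Y f"
  shows "f n ` carrier (Mdl X n) = carrier (Mdl Y n)"
proof -
  have f: "f \<in> chain_maps R X Y" using epic by (simp add: epic_def)
  obtain Q c where Q: "chain_complex R Q" "Q \<in> complexes" and c: "c \<in> chain_maps R Y Q"
    and ker: "\<And>n y. y \<in> carrier (Mdl Y n) \<Longrightarrow>
      c n y = \<zero>\<^bsub>Mdl Q n\<^esub> \<longleftrightarrow> y \<in> f n ` carrier (Mdl X n)"
    by (rule cokernel_data[OF X Y f]) blast
  let ?z = "\<lambda>n. restrict (\<lambda>x. \<zero>\<^bsub>Mdl Q n\<^esub>) (carrier (Mdl Y n))"
  note z = chain_map_zero_map[OF Y(1) Q(1)]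
  have "(\<lambda>n. compose (carrier (Mdl X n)) (c n) (f n)) = (\<lambda>n. compose (carrier (Mdl X n)) (?z n) (f n))"
    by (rule chain_map_eqI[OF chain_map_comp[OF X f c] chain_map_comp[OF X f z]])
      (simp add: compose_eq ker chain_map_closed[OF f])
  then have "c = ?z" using epic Q c z by (simp add: epic_def)
  then have "y \<in> f n ` carrier (Mdl X n)" if "y \<in> carrier (Mdl Y n)" for y
    using ker[OF that] that by simp
  then show ?thesis using chain_map_closed[OF f] by blast
qed

theorem abelian_complexes_category: "abelian_category complexes_category"
proof (rule abelian_category.intro[OF preadditive_full_subcategory abelian_category_axioms.intro])
  let ?C = complexes_category
  show "\<exists>Z. zero_object ?C Z"
  proof -
    obtain Z :: "('r, 'm) chain_cplx" where Z: "chain_complex R Z"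
      and carr: "\<And>n. carrier (Mdl Z n) = {\<zero>\<^bsub>Mdl Z n\<^esub>}"
      using zero_complex[OF cring] by blast
    have "Z \<in> complexes"
      using zero_closed[OF chain_complex_module[OF Z] carr] by (simp add: complexes_def)
    moreover have "\<exists>!f. f \<in> chain_maps R Z T" if T: "chain_complex R T" for T
    proof (rule ex1I, rule chain_map_zero_map[OF Z T])
      fix f assume f: "f \<in> chain_maps R Z T"
      show "f = (\<lambda>n. restrict (\<lambda>x. \<zero>\<^bsub>Mdl T n\<^esub>) (carrier (Mdl Z n)))"
        by (rule chain_map_eqI[OF f chain_map_zero_map[OF Z T]])
          (use chain_map_zero[OF Z T f] in \<open>simp add: carr\<close>)
    qed
    moreover have "\<exists>!f. f \<in> chain_maps R T Z" if T: "chain_complex R T" for T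
    proof (rule ex1I, rule chain_map_zero_map[OF T Z])
      fix f assume f: "f \<in> chain_maps R T Z"
      show "f = (\<lambda>n. restrict (\<lambda>x. \<zero>\<^bsub>Mdl Z n\<^esub>) (carrier (Mdl T n)))"
        by (rule chain_map_eqI[OF f chain_map_zero_map[OF T Z]])
          (use chain_map_closed[OF f] carr in simp)
    qed
    ultimately show ?thesis using Z unfolding zero_object_def subcategory_simps by blast
  qed
  fix X Y assume "X \<in> Obj ?C" "Y \<in> Obj ?C"
  then have X: "chain_complex R X" "X \<in> complexes" and Y: "chain_complex R Y" "Y \<in> complexes"
    by simp_all
  show "\<exists>P i j p q. is_biproduct ?C X Y P i j p q"
  proof -
    obtain D :: "('r, 'm) chain_cplx" and i j p q where D: "chain_complex R D"
      and i: "i \<in> chain_maps R X D" and j: "j \<in> chain_maps R Y D"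
      and p: "p \<in> chain_maps R D X" and q: "q \<in> chain_maps R D Y"
      and pi: "\<And>n x. x \<in> carrier (Mdl X n) \<Longrightarrow> p n (i n x) = x"
      and qj: "\<And>n y. y \<in> carrier (Mdl Y n) \<Longrightarrow> q n (j n y) = y"
      and qi: "\<And>n x. x \<in> carrier (Mdl X n) \<Longrightarrow> q n (i n x) = \<zero>\<^bsub>Mdl Y n\<^esub>"
      and pj: "\<And>n y. y \<in> carrier (Mdl Y n) \<Longrightarrow> p n (j n y) = \<zero>\<^bsub>Mdl X n\<^esub>"
      and sum: "\<And>n z. z \<in> carrier (Mdl D n) \<Longrightarrow> i n (p n z) \<oplus>\<^bsub>Mdl D n\<^esub> j n (q n z) = z"
      by (rule direct_sum_complex[OF infinite_universe X(1) Y(1)]) blast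
    have "P (Mdl D n)" for n
    proof (rule pair_closed[OF chain_complex_module[OF X(1)] chain_complex_module[OF Y(1)]
          chain_complex_module[OF D] _ _ chain_map_hom[OF p] chain_map_hom[OF q]])
      show "x = y" if "x \<in> carrier (Mdl D n)" "y \<in> carrier (Mdl D n)" "p n x = p n y" "q n x = q n y"
        for x y using sum[OF that(1)] sum[OF that(2)] that(3,4) by metis
    qed (use X(2) Y(2) in \<open>simp_all add: complexes_def\<close>)
    then have DC: "D \<in> complexes" by (simp add: complexes_def)
    note comp = chain_map_comp[OF X(1) i p] chain_map_comp[OF Y(1) j q]
      chain_map_comp[OF X(1) i q] chain_map_comp[OF Y(1) j p]
    note ids = chain_map_id[OF X(1)] chain_map_id[OF Y(1)]
      chain_map_zero_map[OF X(1) Y(1)] chain_map_zero_map[OF Y(1) X(1)]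
    have "is_biproduct ?C X Y D i j p q"
      unfolding is_biproduct_def subcategory_simps
    proof (intro conjI)
      show "(\<lambda>n. compose (carrier (Mdl X n)) (p n) (i n)) = (\<lambda>n. restrict id (carrier (Mdl X n)))"
        by (rule chain_map_eqI[OF comp(1) ids(1)]) (simp add: compose_eq pi)
      show "(\<lambda>n. compose (carrier (Mdl Y n)) (q n) (j n)) = (\<lambda>n. restrict id (carrier (Mdl Y n)))"
        by (rule chain_map_eqI[OF comp(2) ids(2)]) (simp add: compose_eq qj)
      show "(\<lambda>n. compose (carrier (Mdl X n)) (q n) (i n))
          = (\<lambda>n. restrict (\<lambda>x. \<zero>\<^bsub>Mdl Y n\<^esub>) (carrier (Mdl X n)))"
        by (rule chain_map_eqI[OF comp(3) ids(3)]) (simp add: compose_eq qi)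
      show "(\<lambda>n. compose (carrier (Mdl Y n)) (p n) (j n))
          = (\<lambda>n. restrict (\<lambda>x. \<zero>\<^bsub>Mdl X n\<^esub>) (carrier (Mdl Y n)))"
        by (rule chain_map_eqI[OF comp(4) ids(4)]) (simp add: compose_eq pj)
      show "(\<lambda>n. restrict (\<lambda>x. compose (carrier (Mdl D n)) (i n) (p n) x \<oplus>\<^bsub>Mdl D n\<^esub>
          compose (carrier (Mdl D n)) (j n) (q n) x) (carrier (Mdl D n)))
          = (\<lambda>n. restrict id (carrier (Mdl D n)))"
        by (rule chain_map_eqI[OF chain_map_plus[OF D D chain_map_comp[OF D p i]
                chain_map_comp[OF D q j]] chain_map_id[OF D]])
          (simp add: compose_eq sum)
    qed (use D DC i j p q in simp_all)
    then show ?thesis by blast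
  qed
  show "\<exists>K k. is_kernel ?C X Y f K k" if "f \<in> Hom ?C X Y" for f
  proof -
    have f: "f \<in> chain_maps R X Y" using that by simp
    obtain K k where K: "chain_complex R K" "K \<in> complexes" and k: "k \<in> chain_maps R K X"
      and inj: "\<And>n. inj_on (k n) (carrier (Mdl K n))"
      and img: "\<And>n. k n ` carrier (Mdl K n) = {x \<in> carrier (Mdl X n). f n x = \<zero>\<^bsub>Mdl Y n\<^esub>}"
      by (rule kernel_data[OF X Y(1) f]) blast
    show ?thesis
      by (intro exI, rule is_kernelI[OF X(1) Y(1) K f k inj img])
  qed
  show "\<exists>Q c. is_cokernel ?C X Y f Q c" if "f \<in> Hom ?C X Y" for f
  proof -
    have f: "f \<in> chain_maps R X Y" using that by simp
    obtain Q c where Q: "chain_complex R Q" "Q \<in> complexes" and c: "c \<in> chain_maps R Y Q"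
      and surj: "\<And>n. c n ` carrier (Mdl Y n) = carrier (Mdl Q n)"
      and ker: "\<And>n y. y \<in> carrier (Mdl Y n) \<Longrightarrow>
        c n y = \<zero>\<^bsub>Mdl Q n\<^esub> \<longleftrightarrow> y \<in> f n ` carrier (Mdl X n)"
      by (rule cokernel_data[OF X(1) Y f]) blast
    show ?thesis
      by (intro exI, rule is_cokernelI[OF X(1) Y(1) Q f c surj ker])
  qed
  show "\<exists>Z g. Z \<in> Obj ?C \<and> g \<in> Hom ?C Y Z \<and> is_kernel ?C Y Z g X f" if monic: "monic ?C X Y f" for f
  proof -
    have f: "f \<in> chain_maps R X Y" using monic by (simp add: monic_def)
    obtain Q c where Q: "chain_complex R Q" "Q \<in> complexes" and c: "c \<in> chain_maps R Y Q"
      and ker: "\<And>n y. y \<in> carrier (Mdl Y n) \<Longrightarrow>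
        c n y = \<zero>\<^bsub>Mdl Q n\<^esub> \<longleftrightarrow> y \<in> f n ` carrier (Mdl X n)"
      by (rule cokernel_data[OF X(1) Y f]) blast
    have "f n ` carrier (Mdl X n) = {y \<in> carrier (Mdl Y n). c n y = \<zero>\<^bsub>Mdl Q n\<^esub>}" for n
      by (auto simp: ker chain_map_closed[OF f] simp del: image_iff)
    then have "is_kernel ?C Y Q c X f"
      by (rule is_kernelI[OF Y(1) Q(1) X c f monic_imp_inj[OF X Y(1) monic]])
    then show ?thesis using Q c by auto
  qed
  show "\<exists>W g. W \<in> Obj ?C \<and> g \<in> Hom ?C W X \<and> is_cokernel ?C W X g Y f" if epic: "epic ?C X Y f" for f
  proof -
    have f: "f \<in> chain_maps R X Y" using epic by (simp add: epic_def)
    obtain K k where K: "chain_complex R K" "K \<in> complexes" and k: "k \<in> chain_maps R K X"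
      and img: "\<And>n. k n ` carrier (Mdl K n) = {x \<in> carrier (Mdl X n). f n x = \<zero>\<^bsub>Mdl Y n\<^esub>}"
      by (rule kernel_data[OF X Y(1) f]) blast
    have "is_cokernel ?C K X k Y f"
      by (rule is_cokernelI[OF K(1) X(1) Y k f epic_imp_surj[OF X(1) Y epic]]) (simp add: img)
    then show ?thesis using K k by auto
  qed
qed

end


section \<open>Modules annihilated by an idempotent ideal\<close>

text \<open>
  An equation \<open>r x = 0\<close> passes to surjective images, and it can be tested after applying a jointly injective
  pair of homomorphisms.
\<close>

lemma abelian_module_class_annihilated:
  assumes "cring R" "infinite (UNIV :: 'm set)" "I \<subseteq> carrier R"
  shows "abelian_module_class R (\<lambda>M :: ('r, 'm) module. \<forall>r\<in>I. \<forall>x\<in>carrier M. r \<odot>\<^bsub>M\<^esub> x = \<zero>\<^bsub>M\<^esub>)"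
proof (rule abelian_module_class.intro)
  show "cring R" "infinite (UNIV :: 'm set)" by fact+
next
  fix M :: "('r, 'm) module"
  assume "module R M" and carr: "carrier M = {\<zero>\<^bsub>M\<^esub>}"
  then interpret M: module R M by simp
  show "\<forall>r\<in>I. \<forall>x\<in>carrier M. r \<odot>\<^bsub>M\<^esub> x = \<zero>\<^bsub>M\<^esub>"
    using assms(3) by (auto simp: carr)
next
  fix M N Q :: "('r, 'm) module" and p q
  assume M: "module R M" and N: "module R N" and Q: "module R Q"
    and IM: "\<forall>r\<in>I. \<forall>x\<in>carrier M. r \<odot>\<^bsub>M\<^esub> x = \<zero>\<^bsub>M\<^esub>" and IN: "\<forall>r\<in>I. \<forall>x\<in>carrier N. r \<odot>\<^bsub>N\<^esub> x = \<zero>\<^bsub>N\<^esub>"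
    and p: "p \<in> mod_hom R Q M" and q: "q \<in> mod_hom R Q N"
    and inj: "\<And>x y. \<lbrakk>x \<in> carrier Q; y \<in> carrier Q; p x = p y; q x = q y\<rbrakk> \<Longrightarrow> x = y"
  interpret Q: module R Q by (rule Q)
  show "\<forall>r\<in>I. \<forall>x\<in>carrier Q. r \<odot>\<^bsub>Q\<^esub> x = \<zero>\<^bsub>Q\<^esub>"
  proof (intro ballI)
    fix r x assume "r \<in> I" and x: "x \<in> carrier Q"
    with assms(3) have r: "r \<in> I" "r \<in> carrier R" by auto
    show "r \<odot>\<^bsub>Q\<^esub> x = \<zero>\<^bsub>Q\<^esub>"
      by (rule inj) (use r x IM IN in \<open>simp_all add: mod_hom_smult[OF p] mod_hom_smult[OF q]
          mod_hom_closed[OF p] mod_hom_closed[OF q] mod_hom_zero[OF Q M p] mod_hom_zero[OF Q N q]\<close>)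
  qed
next
  fix M N :: "('r, 'm) module" and f
  assume M: "module R M" and N: "module R N" and f: "f \<in> mod_hom R M N"
    and IM: "\<forall>r\<in>I. \<forall>x\<in>carrier M. r \<odot>\<^bsub>M\<^esub> x = \<zero>\<^bsub>M\<^esub>" and surj: "f ` carrier M = carrier N"
  show "\<forall>r\<in>I. \<forall>y\<in>carrier N. r \<odot>\<^bsub>N\<^esub> y = \<zero>\<^bsub>N\<^esub>"
  proof (intro ballI)
    fix r y assume r: "r \<in> I" and "y \<in> carrier N"
    then obtain x where x: "x \<in> carrier M" "y = f x" using surj by auto
    show "r \<odot>\<^bsub>N\<^esub> y = \<zero>\<^bsub>N\<^esub>"
      using mod_hom_smult[OF f _ x(1), of r] r x IM assms(3) mod_hom_zero[OF M N f] by auto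
  qed
qed

theorem corollary3p2:
  fixes A :: "('r, 'x) ring_scheme" and \<aa> :: "'r set"
  assumes "cring A"
    and "ideal \<aa> A"
    and "\<aa> = \<aa> \<cdot>\<^bsub>A\<^esub> \<aa>"
    and "infinite (UNIV :: 'm set)"
  shows "abelian_category
    (complete_complex_category A \<aa> :: (('r, 'm) chain_cplx, int \<Rightarrow> 'm \<Rightarrow> 'm) ab_precat)"
proof -
  interpret I: ideal \<aa> A by fact
  interpret K: abelian_module_class A
    "\<lambda>M :: ('r, 'm) module. \<forall>r\<in>\<aa>. \<forall>x\<in>carrier M. r \<odot>\<^bsub>M\<^esub> x = \<zero>\<^bsub>M\<^esub>"
    by (rule abelian_module_class_annihilated[OF assms(1,4)]) (auto simp: I.Icarr)
  have "(complete_complex_category A \<aa> :: (('r, 'm) chain_cplx, int \<Rightarrow> 'm \<Rightarrow> 'm) ab_precat)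
      = K.complexes_category"
    unfolding complete_complex_category_def full_subcategory_def
    using adically_complete_iff_annihilated[OF chain_complex_module assms(2,3)]
    by (auto simp: complex_category_def K.complexes_def)
  then show ?thesis using K.abelian_complexes_category by simp
qed

end
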